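(* Let $k\ge 3$ and $m\ge 2k-1$ be integers, and set $n=km$. Let $H_{n,k}=K_{k-2}\vee\bigl(K_{n-k+1}\cup K_1\bigr)$. If $G$ is an $n$-vertex graph containing no $K_k$-factor, then \[ \rho(G)\le \rho(H_{n,k}). \] Moreover, equality holds if and only if $G\cong H_{n,k}$.
   Context: All graphs are finite, simple, and undirected. For a graph $G$, $\rho(G)$ denotes its spectral radius, i.e. the spectral radius of its adjacency matrix $A(G)$. $K_r$ denotes the complete graph on $r$ vertices, $\cup$ denotes the disjoint union of graphs, and $\vee$ denotes the join of two vertex-disjoint graphs (the disjoint union together with all edges between the two vertex sets). Equivalently, $H_{n,k}$ is obtained from the clique $K_{n-1}$ by adding one new vertex adjacent to exactly $k-2$ vertices of the clique. A $K_k$-factor in a graph on $n=km$ vertices is a collection of $m$ pairwise vertex-disjoint copies of $K_k$ (as subgraphs) that together cover the entire vertex set. *)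

theory Defs
  imports
    "Graph_Theory.Digraph_Isomorphism"
    "Graph_Theory.Kuratowski"
    "Jordan_Normal_Form.Spectral_Radius"
begin

text \<open>
  A finite simple undirected graph is a \<^locale>\<open>pair_graph\<close>: finitely many vertices, no loops, and
  a symmetric arc set, so that an edge is represented by its two orientations.
\<close>

definition complete_graph :: "nat \<Rightarrow> nat pair_pre_digraph" where
  "complete_graph r = \<lparr> pverts = {..<r}, parcs = {(u, v). u < r \<and> v < r \<and> u \<noteq> v} \<rparr>"

definition disjoint_union ::
    "'a pair_pre_digraph \<Rightarrow> 'b pair_pre_digraph \<Rightarrow> ('a + 'b) pair_pre_digraph" where
  "disjoint_union G H =
     \<lparr> pverts = pverts G <+> pverts H,
       parcs = map_prod Inl Inl ` parcs G \<union> map_prod Inr Inr ` parcs H \<rparr>"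

definition graph_join ::
    "'a pair_pre_digraph \<Rightarrow> 'b pair_pre_digraph \<Rightarrow> ('a + 'b) pair_pre_digraph" where
  "graph_join G H =
     \<lparr> pverts = pverts (disjoint_union G H),
       parcs = parcs (disjoint_union G H)
         \<union> (Inl ` pverts G) \<times> (Inr ` pverts H)
         \<union> (Inr ` pverts H) \<times> (Inl ` pverts G) \<rparr>"

definition extremal_graph :: "nat \<Rightarrow> nat \<Rightarrow> (nat + (nat + nat)) pair_pre_digraph" where
  "extremal_graph n k =
     graph_join (complete_graph (k - 2))
       (disjoint_union (complete_graph (n - k + 1)) (complete_graph 1))"

definition is_clique_factor ::
    "nat \<Rightarrow> nat \<Rightarrow> 'a pair_pre_digraph \<Rightarrow> 'a pair_pre_digraph set \<Rightarrow> bool" where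
  "is_clique_factor k m G F \<longleftrightarrow>
     finite F \<and> card F = m \<and>
     (\<forall>C\<in>F. subgraph (with_proj C) (with_proj G) \<and> K\<^bsub>k\<^esub> (with_proj C)) \<and>
     pairwise (\<lambda>C D. pverts C \<inter> pverts D = {}) F \<and>
     (\<Union>C\<in>F. pverts C) = pverts G"

definition adjacency_mat :: "'a list \<Rightarrow> 'a pair_pre_digraph \<Rightarrow> complex mat" where
  "adjacency_mat vs G = mat (length vs) (length vs)
     (\<lambda>(i, j). if (vs ! i, vs ! j) \<in> parcs G then 1 else 0)"

text \<open>
  The rows and columns of the adjacency matrix are ordered by an arbitrary enumeration of the
  vertices; by lemma \<open>graph_spectral_radius_eq\<close> below the choice does not matter.
\<close>

definition graph_spectral_radius :: "'a pair_pre_digraph \<Rightarrow> real" where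
  "graph_spectral_radius G =
     spectral_radius (adjacency_mat (SOME vs. distinct vs \<and> set vs = pverts G) G)"

lemma eigenvalue_adjacency_mat_reorder:
  assumes vs: "distinct vs" and ws: "distinct ws" and eq: "set vs = set ws"
    and ev: "eigenvalue (adjacency_mat vs G) x"
  shows "eigenvalue (adjacency_mat ws G) x"
proof -
  define n where "n = length vs"
  have len: "length vs = n" "length ws = n"
    using distinct_card[OF vs] distinct_card[OF ws] eq by (simp_all add: n_def)
  define p where "p = inv_into {..<n} ((!) vs) \<circ> (!) ws"
  have bvs: "bij_betw ((!) vs) {..<n} (set vs)"
    by (rule bij_betw_nth) (use vs len in auto)
  have bws: "bij_betw ((!) ws) {..<n} (set vs)"
    by (rule bij_betw_nth) (use ws len eq in auto)
  have bp: "bij_betw p {..<n} {..<n}"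
    unfolding p_def using bij_betw_trans[OF bws bij_betw_inv_into[OF bvs]] .
  have p_less: "p i < n" if "i < n" for i
    using bij_betwE[OF bp] that by auto
  have vs_p: "vs ! p i = ws ! i" if "i < n" for i
    unfolding p_def using bij_betw_inv_into_right[OF bvs, of "ws ! i"] bij_betwE[OF bws] that
    by auto
  from ev obtain v where v: "v \<in> carrier_vec n" "v \<noteq> 0\<^sub>v n"
    and Av: "adjacency_mat vs G *\<^sub>v v = x \<cdot>\<^sub>v v"
    unfolding eigenvalue_def eigenvector_def adjacency_mat_def by (auto simp: len)
  define w where "w = vec n (\<lambda>i. v $ p i)"
  have row: "(\<Sum>j<n. (if (vs ! i, vs ! j) \<in> parcs G then 1 else 0) * v $ j) = x * v $ i"
    if i: "i < n" for i
  proof -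
    have "(adjacency_mat vs G *\<^sub>v v) $ i = (x \<cdot>\<^sub>v v) $ i" by (simp add: Av)
    then show ?thesis
      using i v(1) by (simp add: adjacency_mat_def scalar_prod_def len lessThan_atLeast0)
  qed
  have "adjacency_mat ws G *\<^sub>v w = x \<cdot>\<^sub>v w"
  proof (rule eq_vecI)
    fix i assume "i < dim_vec (x \<cdot>\<^sub>v w)"
    then have i: "i < n" by (simp add: w_def)
    have "(adjacency_mat ws G *\<^sub>v w) $ i
        = (\<Sum>j<n. (if (ws ! i, ws ! j) \<in> parcs G then 1 else 0) * v $ p j)"
      using i by (simp add: adjacency_mat_def scalar_prod_def len w_def lessThan_atLeast0)
    also have "\<dots> = (\<Sum>j<n. (if (vs ! p i, vs ! p j) \<in> parcs G then 1 else 0) * v $ p j)"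
      by (rule sum.cong) (use i vs_p in auto)
    also have "\<dots> = (\<Sum>j<n. (if (vs ! p i, vs ! j) \<in> parcs G then 1 else 0) * v $ j)"
      by (rule sum.reindex_bij_betw[OF bp])
    also have "\<dots> = (x \<cdot>\<^sub>v w) $ i"
      using row[OF p_less[OF i]] i by (simp add: w_def)
    finally show "(adjacency_mat ws G *\<^sub>v w) $ i = (x \<cdot>\<^sub>v w) $ i" .
  qed (simp add: adjacency_mat_def w_def len)
  moreover have "w \<noteq> 0\<^sub>v n"
  proof
    assume w0: "w = 0\<^sub>v n"
    have "v = 0\<^sub>v n"
    proof (rule eq_vecI)
      fix j assume "j < dim_vec (0\<^sub>v n :: complex vec)"
      then have j: "j < n" by simp
      obtain i where i: "i < n" "p i = j"
        using bij_betw_imp_surj_on[OF bp] j by (metis imageE lessThan_iff)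
      from w0 i(1) have "w $ i = 0" by simp
      with i show "v $ j = 0\<^sub>v n $ j" by (simp add: w_def j)
    qed (use v(1) in simp)
    with v(2) show False by simp
  qed
  ultimately show ?thesis
    unfolding eigenvalue_def eigenvector_def
    by (intro exI[of _ w]) (simp add: adjacency_mat_def len w_def)
qed

lemma graph_spectral_radius_eq:
  assumes "distinct vs" and "set vs = pverts G"
  shows "graph_spectral_radius G = spectral_radius (adjacency_mat vs G)"
proof -
  define us where "us = (SOME us. distinct us \<and> set us = pverts G)"
  have us: "distinct us \<and> set us = pverts G"
    unfolding us_def by (rule someI[of _ vs]) (use assms in simp)
  have "spectrum (adjacency_mat us G) = spectrum (adjacency_mat vs G)"
    unfolding spectrum_def using us assms by (blast intro: eigenvalue_adjacency_mat_reorder)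
  then show ?thesis
    by (simp add: graph_spectral_radius_def spectral_radius_def us_def)
qed

lemma complete_digraph_complete_graph: "K\<^bsub>r\<^esub> (with_proj (complete_graph r))"
  by (auto simp: complete_digraph_pair_def complete_graph_def)

lemma pair_graph_disjoint_union:
  assumes "pair_graph G" and "pair_graph H"
  shows "pair_graph (disjoint_union G H)"
proof -
  interpret G: pair_graph G by fact
  interpret H: pair_graph H by fact
  show ?thesis
    using G.pair_sym_arcs H.pair_sym_arcs
    by unfold_locales
      (auto simp: disjoint_union_def symmetric_def sym_def
        dest: G.in_arcsD1 G.in_arcsD2 H.in_arcsD1 H.in_arcsD2 G.pair_no_loops H.pair_no_loops)
qed

lemma pair_graph_graph_join:
  assumes "pair_graph G" and "pair_graph H"
  shows "pair_graph (graph_join G H)"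
proof -
  interpret U: pair_graph "disjoint_union G H"
    by (rule pair_graph_disjoint_union[OF assms])
  have fin: "finite (pverts G)" "finite (pverts H)"
    using assms by (simp_all add: pair_graph_def pair_digraph_def
        pair_fin_digraph_def pair_fin_digraph_axioms_def)
  show ?thesis
    using U.pair_sym_arcs U.finite_arcs U.finite_verts fin
    by unfold_locales
      (auto simp: graph_join_def symmetric_def sym_def
        dest: U.in_arcsD1 U.in_arcsD2 U.pair_no_loops, auto simp: disjoint_union_def)
qed

lemma pair_graph_extremal_graph: "pair_graph (extremal_graph n k)"
  unfolding extremal_graph_def
  by (intro pair_graph_graph_join pair_graph_disjoint_union
      pair_graphI_complete[OF complete_digraph_complete_graph])

lemma card_extremal_graph:
  assumes "2 \<le> k" and "k \<le> n"
  shows "card (pverts (extremal_graph n k)) = n"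
  using assms by (simp add: extremal_graph_def graph_join_def disjoint_union_def
      complete_graph_def card_Plus)

end

theory Submission
  imports Defs
begin

text \<open>
  Let \<open>R\<close> be the complement of \<open>G\<close>; a \<open>K\<^sub>k\<close>-factor of \<open>G\<close> is an equitable colouring of \<open>R\<close> with \<open>m\<close>
  classes. Such a colouring exists as soon as \<open>R\<close> has at most \<open>n - k\<close> edges: restore the edges one at a
  time, each at a vertex \<open>u\<close> of minimum positive degree. By \<open>m \<ge> 2 * k - 1\<close> this degree is less than
  \<open>m\<close>, so \<open>u\<close> can be recoloured, and the two classes of wrong size are repaired by the
  Kierstead--Kostochka shifting argument, which here needs no degree bound because \<open>R\<close> is too sparse
  to obstruct it.

  Hence without a \<open>K\<^sub>k\<close>-factor \<open>R\<close> contains some \<open>S\<close> with exactly \<open>n - k + 1\<close> edges. If \<open>S\<close> is not a star, a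
  positive test vector obtained from the degrees in \<open>S\<close> shows \<open>\<rho>(G) \<le> n - 2 < \<rho>(H)\<close>. If \<open>S\<close> is a
  star, then \<open>G\<close> is a spanning subgraph of a copy of the extremal graph \<open>H\<close>, whose positive eigenvector
  serves as a test vector that is strict unless nothing is missing.

  Complements are symmetric relations, so their cardinality is twice the number of edges.
\<close>

section \<open>Equitable colourings of sparse graphs\<close>

lemma card_eq_sum_card_Image:
  assumes "finite V" and "R \<subseteq> V \<times> V"
  shows "card R = (\<Sum>v\<in>V. card (R `` {v}))"
proof -
  have "card R = card (SIGMA v:V. R `` {v})"
    using assms(2) by (intro arg_cong[of _ _ card]) auto
  moreover have "finite (R `` {v})" for v
    using assms finite_subset[of "R `` {v}" V] by auto
  ultimately show ?thesis
    using assms(1) by simp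
qed

lemma card_remove_sym_pair:
  assumes "finite R" and "sym R" and "irrefl R" and "(u, v) \<in> R"
  shows "card (R - {(u, v), (v, u)}) + 2 = card R"
proof -
  have "(v, u) \<in> R" "u \<noteq> v"
    using assms by (auto dest: symD irreflD)
  then have "card {(u, v), (v, u)} = 2" "{(u, v), (v, u)} \<subseteq> R"
    using assms(4) by auto
  moreover from this have "card {(u, v), (v, u)} \<le> card R"
    using assms(1) card_mono by blast
  ultimately show ?thesis
    using assms(1) by (metis card_Diff_subset finite_subset le_add_diff_inverse2)
qed

text \<open>Arcs are added together with their reverses. A symmetric irreflexive relation has even
  size, so the slack \<open>+ 1\<close> costs nothing and spares users a parity argument.\<close>

lemma sym_subset_of_card:
  assumes "finite R" and "sym R" and "irrefl R" and "2 * N \<le> card R + 1"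
  obtains S where "S \<subseteq> R" and "sym S" and "card S = 2 * N"
  using assms(4)
proof (induction N arbitrary: thesis)
  case 0
  then show ?case
    by (metis card.empty empty_subsetI mult_0_right sym_def empty_iff)
next
  case (Suc N)
  obtain S where S: "S \<subseteq> R" "sym S" "card S = 2 * N"
    using Suc.IH Suc.prems(2) by auto
  moreover have "card S < card R"
    using Suc.prems(2) S(3) by simp
  ultimately obtain u v where uv: "(u, v) \<in> R" "(u, v) \<notin> S"
    by (metis less_irrefl subrelI subset_antisym)
  then have vu: "(v, u) \<in> R" "(v, u) \<notin> S" "u \<noteq> v"
    using assms(2,3) S(2) by (auto dest: symD irreflD)
  have "finite S"
    using S(1) assms(1) finite_subset by blast
  then have "card (insert (u, v) (insert (v, u) S)) = 2 * Suc N"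
    using S(3) uv vu by simp
  moreover have "sym (insert (u, v) (insert (v, u) S))"
    using S(2) by (auto simp: sym_def)
  ultimately show ?case
    using Suc.prems(1) S(1) uv vu by (metis insert_subset)
qed

section \<open>Recolouring single vertices and repairing unbalanced classes\<close>

definition color_class :: "'a set \<Rightarrow> ('a \<Rightarrow> nat) \<Rightarrow> nat \<Rightarrow> 'a set" where
  "color_class V c i = {x \<in> V. c x = i}"

definition proper_coloring :: "'a rel \<Rightarrow> ('a \<Rightarrow> nat) \<Rightarrow> bool" where
  "proper_coloring R c \<longleftrightarrow> (\<forall>(x, y)\<in>R. c x \<noteq> c y)"

definition equitable_coloring :: "'a set \<Rightarrow> 'a rel \<Rightarrow> nat \<Rightarrow> nat \<Rightarrow> ('a \<Rightarrow> nat) \<Rightarrow> bool" where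
  "equitable_coloring V R k m c \<longleftrightarrow>
     c ` V \<subseteq> {..<m} \<and> proper_coloring R c \<and> (\<forall>i<m. card (color_class V c i) = k)"

lemma card_color_class_recolor:
  assumes "finite V" and "x \<in> V" and "c x \<noteq> j"
  shows "card (color_class V (c(x := j)) l) =
    (if l = j then card (color_class V c l) + 1
     else if l = c x then card (color_class V c l) - 1 else card (color_class V c l))"
proof -
  have fin: "finite (color_class V c l)"
    using assms(1) by (simp add: color_class_def)
  consider "l = j" | "l = c x" "l \<noteq> j" | "l \<noteq> j" "l \<noteq> c x" by blast
  then show ?thesis
  proof cases
    case 1
    then have "color_class V (c(x := j)) l = insert x (color_class V c l)"
      using assms by (auto simp: color_class_def)
    moreover have "x \<notin> color_class V c l"
      using 1 assms by (auto simp: color_class_def)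
    ultimately show ?thesis using 1 fin by simp
  next
    case 2
    then have "color_class V (c(x := j)) l = color_class V c l - {x}"
      by (auto simp: color_class_def)
    moreover have "x \<in> color_class V c l"
      using 2 assms by (auto simp: color_class_def)
    ultimately show ?thesis using 2 fin by simp
  next
    case 3
    then have "color_class V (c(x := j)) l = color_class V c l"
      by (auto simp: color_class_def)
    then show ?thesis using 3 by simp
  qed
qed

lemma proper_coloring_recolor:
  assumes "sym R" and "irrefl R" and "R \<subseteq> V \<times> V" and "proper_coloring R c"
    and "R `` {x} \<inter> color_class V c j = {}"
  shows "proper_coloring R (c(x := j))"
  unfolding proper_coloring_def
proof (intro ballI, clarify)
  fix u v assume uv: "(u, v) \<in> R" and eq: "(c(x := j)) u = (c(x := j)) v"
  have "u \<noteq> v" "c u \<noteq> c v" "u \<in> V" "v \<in> V" "(v, u) \<in> R"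
    using uv assms(1-4) by (auto simp: proper_coloring_def dest: symD irreflD)
  then show False
    using eq uv assms(5) by (auto simp: color_class_def split: if_splits)
qed

text \<open>
  The counting behind the Kierstead--Kostochka proof of the Hajnal--Szemeredi theorem: if no short
  sequence of recolourings helps, the small class sends at least one edge to each vertex of every class
  outside \<open>A\<close>, and each vertex of the large class sends one to every class in \<open>A\<close>.
\<close>

lemma equitable_coloring_shift:
  assumes fin: "finite V" and R: "sym R" "irrefl R" "R \<subseteq> V \<times> V"
    and edges: "card R \<le> 2 * (k * (m - 1))"
    and c: "c ` V \<subseteq> {..<m}" "proper_coloring R c"
    and ij: "i < m" "j < m" "i \<noteq> j"
    and card_i: "card (color_class V c i) + 1 = k"
    and card_j: "card (color_class V c j) = k + 1"
    and card_other: "\<And>l. l < m \<Longrightarrow> l \<noteq> i \<Longrightarrow> l \<noteq> j \<Longrightarrow> card (color_class V c l) = k"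
  shows "\<exists>c'. equitable_coloring V R k m c'"
proof (rule ccontr)
  assume no: "\<not> ?thesis"
  let ?C = "color_class V c"
  \<comment> \<open>\<open>A\<close> holds \<open>i\<close> and the colours whose class has a vertex
    that can move to colour \<open>i\<close> at once; the large class \<open>j\<close> is kept
    apart.\<close>
  define A where "A = {l. l < m \<and> l \<noteq> j \<and> (l = i \<or> (\<exists>x\<in>?C l. R `` {x} \<inter> ?C i = {}))}"
  define B where "B = {..<m} - {j} - A"
  \<comment> \<open>Otherwise \<open>w\<close> moves to \<open>l\<close> and, unless
    \<open>l = i\<close>, a movable vertex of class \<open>l\<close> moves on to \<open>i\<close>;
    this balances all classes.\<close>
  have hitW: "R `` {w} \<inter> ?C l \<noteq> {}" if w: "w \<in> ?C j" and l: "l \<in> A" for w l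
  proof
    assume free: "R `` {w} \<inter> ?C l = {}"
    have wV: "w \<in> V" "c w = j" and lj: "l < m" "l \<noteq> j"
      using w l by (auto simp: color_class_def A_def)
    define c1 where "c1 = c(w := l)"
    have c1: "proper_coloring R c1" "c1 ` V \<subseteq> {..<m}"
      using proper_coloring_recolor[OF R c(2) free] c(1) lj by (auto simp: c1_def)
    have card1: "card (color_class V c1 h) =
        (if h = l then card (?C h) + 1 else if h = j then card (?C h) - 1 else card (?C h))" for h
      using card_color_class_recolor[OF fin wV(1), of c l h] wV lj by (simp add: c1_def)
    show False
    proof (cases "l = i")
      case True
      have "card (color_class V c1 h) = k" if "h < m" for h
        using card1[of h] card_i card_j card_other[OF that] True ij(3) by auto
      then have "equitable_coloring V R k m c1"
        unfolding equitable_coloring_def using c1 by blast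
      then show False using no by blast
    next
      case False
      then obtain x where x: "x \<in> ?C l" "R `` {x} \<inter> ?C i = {}"
        using l by (auto simp: A_def)
      have xV: "x \<in> V" "c x = l" "x \<noteq> w"
        using x(1) wV lj by (auto simp: color_class_def)
      have c1x: "c1 x = l" using xV by (simp add: c1_def)
      define c2 where "c2 = c1(x := i)"
      have "color_class V c1 i = ?C i"
        using False ij(3) wV by (auto simp: color_class_def c1_def)
      then have "R `` {x} \<inter> color_class V c1 i = {}"
        using x(2) by simp
      then have "proper_coloring R c2"
        unfolding c2_def by (rule proper_coloring_recolor[OF R c1(1)])
      moreover have "c2 ` V \<subseteq> {..<m}"
        using c1(2) ij(1) by (auto simp: c2_def)
      moreover have "card (color_class V c2 h) =
          (if h = i then card (color_class V c1 h) + 1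
           else if h = l then card (color_class V c1 h) - 1 else card (color_class V c1 h))" for h
        using card_color_class_recolor[OF fin xV(1), of c1 i h] c1x False by (simp add: c2_def)
      then have "card (color_class V c2 h) = k" if "h < m" for h
        using card1 card_i card_j card_other[OF that] card_other[OF lj(1)] False lj ij(3) by auto
      ultimately have "equitable_coloring V R k m c2"
        unfolding equitable_coloring_def by blast
      then show False using no by blast
    qed
  qed
  have hitB: "R `` {x} \<inter> ?C i \<noteq> {}" if "l \<in> B" "x \<in> ?C l" for x l
    using that by (auto simp: B_def A_def)
  have finC: "finite (?C l)" for l
    using fin by (simp add: color_class_def)
  \<comment> \<open>Each pair in \<open>S\<close> is a vertex and a colour in which it must have a
    neighbour; \<open>f\<close> below selects the arc to such a neighbour.\<close>
  define S where "S = (?C j \<times> A) \<union> ((\<Union>l\<in>B. ?C l) \<times> {i})"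
  have finAB: "finite A" "finite B"
    by (auto simp: A_def B_def)
  have AB: "card A + card B = m - 1" "A \<inter> B = {}" "i \<in> A" "j \<notin> A" "j \<notin> B" "i \<notin> B"
  proof -
    show "A \<inter> B = {}" "i \<in> A" "j \<notin> A" "j \<notin> B" "i \<notin> B"
      using ij by (auto simp: A_def B_def)
    moreover have "A \<union> B = {..<m} - {j}" by (auto simp: A_def B_def)
    ultimately show "card A + card B = m - 1"
      using card_Un_disjoint[OF finAB] ij(2) by simp
  qed
  have "card (\<Union>l\<in>B. ?C l) = (\<Sum>l\<in>B. card (?C l))"
    by (rule card_UN_disjoint) (use finAB finC in \<open>auto simp: color_class_def\<close>)
  also have "\<dots> = (\<Sum>l\<in>B. k)"
    by (rule sum.cong) (use card_other AB in \<open>auto simp: B_def\<close>)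
  finally have cardU: "card (\<Union>l\<in>B. ?C l) = card B * k" by simp
  have "?C j \<inter> (\<Union>l\<in>B. ?C l) = {}"
    using AB(5) by (auto simp: color_class_def)
  then have "card S = card (?C j \<times> A) + card ((\<Union>l\<in>B. ?C l) \<times> {i})"
    unfolding S_def by (intro card_Un_disjoint) (use finC finAB in auto)
  also have "\<dots> = (k + 1) * card A + card B * k"
    by (simp add: card_cartesian_product cardU card_j)
  also have "\<dots> = k * (card A + card B) + card A"
    by (simp add: algebra_simps)
  finally have cardS: "card S = k * (m - 1) + card A"
    using AB(1) by simp
  define f where "f = (\<lambda>(x, l). (x, SOME y. y \<in> R `` {x} \<inter> ?C l))"
  have f: "fst (f p) = fst p" "f p \<in> R" "snd (f p) \<in> ?C (snd p)" if "p \<in> S" for p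
  proof -
    obtain x l where p: "p = (x, l)" by fastforce
    have "R `` {x} \<inter> ?C l \<noteq> {}"
      using that hitW hitB unfolding S_def p by blast
    then have "(SOME y. y \<in> R `` {x} \<inter> ?C l) \<in> R `` {x} \<inter> ?C l"
      by (rule some_in_eq[THEN iffD2])
    then show "fst (f p) = fst p" "f p \<in> R" "snd (f p) \<in> ?C (snd p)"
      by (auto simp: f_def p)
  qed
  have "inj_on f S"
  proof (rule inj_onI)
    fix p q assume pq: "p \<in> S" "q \<in> S" "f p = f q"
    then have "fst p = fst q" "snd p = snd q"
      using f[of p] f[of q] by (auto simp: color_class_def)
    then show "p = q" by (rule prod_eqI)
  qed
  then have card_f: "card (f ` S) = card S" by (rule card_image)
  have finR: "finite R" using R(3) fin finite_subset by blast
  have fS: "f ` S \<subseteq> R" using f(2) by blast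
  have inv: "(f ` S)\<inverse> \<subseteq> R" using fS R(1) by (auto dest: symD)
  \<comment> \<open>Selected arcs lead from colours outside \<open>A\<close> to colours in
    \<open>A\<close>, so none is the reverse of another and each accounts for two arcs of
    \<open>R\<close>.\<close>
  have "c (fst (f p)) \<notin> A" "c (snd (f p)) \<in> A" if "p \<in> S" for p
    using f[OF that] that AB by (auto simp: S_def color_class_def)
  then have "f ` S \<inter> (f ` S)\<inverse> = {}"
    by (auto simp: disjoint_iff) (metis fst_conv snd_conv)
  then have "card (f ` S) + card ((f ` S)\<inverse>) = card (f ` S \<union> (f ` S)\<inverse>)"
    by (intro card_Un_disjoint[symmetric]) (use fS inv finR finite_subset in auto)
  also have "\<dots> \<le> card R"
    using fS inv finR by (intro card_mono) auto
  finally have "2 * card S \<le> card R"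
    using card_f by (simp add: card_inverse)
  \<comment> \<open>Since \<open>i\<close> lies in \<open>A\<close>, \<open>card S\<close> strictly
    exceeds \<open>k * (m - 1)\<close>.\<close>
  moreover have "card A > 0" using AB(3) finAB by (auto simp: card_gt_0_iff)
  ultimately show False using edges cardS by simp
qed

text \<open>Number the vertices and cut the numbering into blocks of length
  \<open>k\<close>.\<close>

lemma equitable_coloring_empty:
  assumes "finite V" and "card V = k * m" and "k > 0"
  shows "\<exists>c. equitable_coloring V {} k m c"
proof -
  obtain h where h: "bij_betw h V {0..<k * m}"
    using ex_bij_betw_finite_nat[OF assms(1)] assms(2) by auto
  define c where "c x = h x div k" for x
  have "c x < m" if "x \<in> V" for x
  proof -
    have "h x < m * k"
      using bij_betwE[OF h] that by (auto simp: mult.commute)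
    then show ?thesis
      unfolding c_def by (rule less_mult_imp_div_less)
  qed
  moreover have "card (color_class V c i) = k" if "i < m" for i
  proof -
    have le: "i * k + k \<le> k * m"
      using mult_le_mono1[of "Suc i" m k] that by (simp add: algebra_simps)
    have div_eq: "t div k = i \<longleftrightarrow> t \<in> {i * k..<i * k + k}" for t
      using less_eq_div_iff_mult_less_eq[OF assms(3), of i t]
        div_less_iff_less_mult[OF assms(3), of t "Suc i"] by (auto simp: algebra_simps)
    have "{t \<in> {0..<k * m}. t div k = i} = {0..<k * m} \<inter> {i * k..<i * k + k}"
      unfolding div_eq by blast
    also have "\<dots> = {i * k..<i * k + k}"
      using le by auto
    finally have "{t \<in> {0..<k * m}. t div k = i} = {i * k..<i * k + k}" .
    moreover have "h ` color_class V c i = {t \<in> h ` V. t div k = i}"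
      by (auto simp: color_class_def c_def)
    ultimately have "h ` color_class V c i = {i * k..<i * k + k}"
      using bij_betw_imp_surj_on[OF h] by simp
    moreover have "inj_on h (color_class V c i)"
      using bij_betw_imp_inj_on[OF h] by (rule inj_on_subset) (auto simp: color_class_def)
    ultimately show ?thesis
      by (metis card_atLeastLessThan card_image add_diff_cancel_left')
  qed
  ultimately show ?thesis
    by (auto simp: equitable_coloring_def proper_coloring_def)
qed

theorem equitable_coloring_sparse:
  assumes "finite V" and "card V = k * m" and "k > 0" and "m \<ge> 2 * k - 1"
    and "sym R" and "irrefl R" and "R \<subseteq> V \<times> V" and "card R \<le> 2 * (k * (m - 1))"
  shows "\<exists>c. equitable_coloring V R k m c"
  using assms(5-8)
proof (induction "card R" arbitrary: R rule: less_induct)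
  case less
  note R = less.prems(1-3)
  have finR: "finite R"
    using R(3) assms(1) finite_subset by blast
  have finN: "finite (R `` {x})" for x
    using finR by (rule finite_Image)
  show ?case
  proof (cases "R = {}")
    case True
    then show ?thesis using equitable_coloring_empty assms by blast
  next
    case False
    have m: "m \<ge> 1" using assms(3,4) by simp
    define d where "d x = card (R `` {x})" for x
    obtain u where u: "u \<in> Domain R" and umin: "\<And>x. x \<in> Domain R \<Longrightarrow> d u \<le> d x"
      using arg_min_if_finite(1)[of "Domain R" d] arg_min_least[of "Domain R" _ d]
        finite_Domain[OF finR] False by (metis Domain_empty_iff)
    \<comment> \<open>\<open>u\<close> and its neighbours are \<open>d u + 1\<close> vertices of
      degree at least \<open>d u\<close>, which bounds \<open>(d u + 1) * d u\<close> by the number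
      of arcs.\<close>
    have "insert u (R `` {u}) \<subseteq> Domain R"
      using u R(1) by (auto dest: symD)
    moreover have "u \<notin> R `` {u}"
      using R(2) by (auto dest: irreflD)
    ultimately have "d u + 1 \<le> card (Domain R)"
      using card_mono[OF finite_Domain[OF finR]] finN d_def
      by (metis card_insert_disjoint Suc_eq_plus1)
    then have "(d u + 1) * d u \<le> card (Domain R) * d u"
      by (rule mult_le_mono1)
    also have "\<dots> = (\<Sum>x\<in>Domain R. d u)"
      by simp
    also have "\<dots> \<le> (\<Sum>x\<in>Domain R. d x)"
      by (rule sum_mono) (rule umin)
    also have "\<dots> = card R"
    proof -
      have "R \<subseteq> Domain R \<times> Domain R"
        using R(1) by (auto dest: symD)
      then show ?thesis
        using card_eq_sum_card_Image[OF finite_Domain[OF finR]] by (simp add: d_def)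
    qed
    finally have dd: "(d u + 1) * d u \<le> 2 * (k * (m - 1))"
      using less.prems(4) by simp
    \<comment> \<open>From \<open>d u \<ge> m\<close> and \<open>2 * k \<le> m + 1\<close> would
      follow \<open>(m + 1) * m \<le> (m + 1) * (m - 1)\<close>.\<close>
    have du: "d u < m"
    proof (rule ccontr)
      assume "\<not> d u < m"
      then have "(m + 1) * m \<le> (d u + 1) * d u"
        by (intro mult_le_mono) auto
      also have "\<dots> \<le> (2 * k) * (m - 1)" using dd by simp
      also have "\<dots> \<le> (m + 1) * (m - 1)"
        using assms(4) by (intro mult_le_mono) auto
      also have "\<dots> < (m + 1) * m"
        using m by (intro mult_less_mono2) auto
      finally show False by simp
    qed
    obtain v where uv: "(u, v) \<in> R" using u by blast
    define R' where "R' = R - {(u, v), (v, u)}"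
    have "card R' + 2 = card R"
      unfolding R'_def by (rule card_remove_sym_pair[OF finR R(1,2) uv])
    moreover have R': "sym R'" "irrefl R'" "R' \<subseteq> V \<times> V"
      using R by (auto simp: R'_def sym_def irrefl_def)
    ultimately obtain c where c: "equitable_coloring V R' k m c"
      using less.hyps[of R'] less.prems(4) by auto
    have uV: "u \<in> V" "v \<in> V" "u \<noteq> v"
      using uv R by (auto dest: irreflD)
    show ?thesis
    proof (cases "c u = c v")
      case False
      then have "proper_coloring R c"
        using c by (auto simp: equitable_coloring_def proper_coloring_def R'_def)
      then show ?thesis
        using c by (auto simp: equitable_coloring_def)
    next
      case True
      have c': "c ` V \<subseteq> {..<m}" "proper_coloring R' c" "\<And>i. i < m \<Longrightarrow> card (color_class V c i) = k"
        using c by (auto simp: equitable_coloring_def)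
      have cu: "c u < m" using c'(1) uV by auto
      have "c ` (R `` {u}) = c ` (R `` {u} - {v}) \<union> {c u}"
        using True uv by auto
      then have "card (c ` (R `` {u})) \<le> card (R `` {u} - {v}) + 1"
        using card_image_le[of "R `` {u} - {v}" c] finN[of u]
          card_Un_le[of "c ` (R `` {u} - {v})" "{c u}"] by simp
      also have "\<dots> = d u"
        using card_Suc_Diff1[OF finN, of v u] uv by (simp add: d_def)
      finally have "card (c ` (R `` {u})) < card {..<m}"
        using du by simp
      \<comment> \<open>The neighbours of \<open>u\<close> show at most \<open>d u < m\<close>
        colours, so some colour is free; it differs from \<open>c u\<close> because the neighbour
        \<open>v\<close> has colour \<open>c u\<close>.\<close>
      then obtain j where j: "j < m" "j \<notin> c ` (R `` {u})"
        by (metis card_mono finN finite_imageI lessThan_iff linorder_not_le subsetI)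
      have ju: "j \<noteq> c u"
        using j(2) True uv by auto
      define c1 where "c1 = c(u := j)"
      have "R' `` {u} \<inter> color_class V c j = {}"
        using j(2) by (auto simp: R'_def color_class_def)
      then have "proper_coloring R' c1"
        unfolding c1_def by (rule proper_coloring_recolor[OF R' c'(2)])
      moreover have "c1 u \<noteq> c1 v"
        using ju True uV by (simp add: c1_def)
      ultimately have "proper_coloring R c1"
        by (auto simp: proper_coloring_def R'_def)
      moreover have "c1 ` V \<subseteq> {..<m}"
        using c'(1) j(1) by (auto simp: c1_def)
      moreover have cards: "card (color_class V c1 l) =
          (if l = j then k + 1 else if l = c u then k - 1 else k)" if "l < m" for l
        using card_color_class_recolor[OF assms(1) uV(1), of c j l] c'(3)[OF that] ju
        by (auto simp: c1_def)
      \<comment> \<open>Classes \<open>c u\<close> and \<open>j\<close> now have sizes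
        \<open>k - 1\<close> and \<open>k + 1\<close> and all others size \<open>k\<close>, the
        situation that shifting repairs.\<close>
      ultimately show ?thesis
        using equitable_coloring_shift[OF assms(1) R less.prems(4), of c1 "c u" j]
          cards[OF cu] cards[OF j(1)] cards cu j(1) ju assms(3) by auto
    qed
  qed
qed

section \<open>Spectral radius and positive test vectors\<close>

lemma Image_parcs_subset:
  assumes "pair_graph G"
  shows "parcs G `` {v} \<subseteq> pverts G"
proof -
  interpret pair_graph G by fact
  show ?thesis using in_arcsD2 by auto
qed

text \<open>This is the self-adjointness of the adjacency operator for the pairing
  \<open>\<Sum>v\<in>V. f v * g v\<close>.\<close>

lemma sum_nbrs_swap:
  fixes f g :: "'a \<Rightarrow> real"
  assumes "finite V" and "sym E" and "E \<subseteq> V \<times> V"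
  shows "(\<Sum>v\<in>V. f v * sum g (E `` {v})) = (\<Sum>v\<in>V. sum f (E `` {v}) * g v)"
proof -
  have nb: "sum h (E `` {v}) = (\<Sum>u\<in>V. if (v, u) \<in> E then h u else 0)" for h :: "'a \<Rightarrow> real" and v
    by (rule sum.mono_neutral_cong_left) (use assms in auto)
  have "(\<Sum>v\<in>V. f v * sum g (E `` {v})) = (\<Sum>v\<in>V. \<Sum>u\<in>V. if (v, u) \<in> E then f v * g u else 0)"
    unfolding nb sum_distrib_left by (intro sum.cong) auto
  also have "\<dots> = (\<Sum>u\<in>V. \<Sum>v\<in>V. if (v, u) \<in> E then f v * g u else 0)"
    by (rule sum.swap)
  also have "\<dots> = (\<Sum>u\<in>V. sum f (E `` {u}) * g u)"
    unfolding nb sum_distrib_right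
    by (intro sum.cong) (use assms(2) in \<open>auto dest: symD\<close>)
  finally show ?thesis .
qed

text \<open>The spectral arguments work with neighbour sums of functions on vertices; this is the
  passage to them from the matrix.\<close>

lemma adjacency_mat_mult_vec:
  assumes "pair_graph G" and "distinct vs" and "set vs = pverts G" and "i < length vs"
    and "dim_vec z = length vs" and "\<And>j. j < length vs \<Longrightarrow> z $ j = y (vs ! j)"
  shows "(adjacency_mat vs G *\<^sub>v z) $ i = sum y (parcs G `` {vs ! i})"
proof -
  have fin: "finite (pverts G)" using assms(3) by (metis List.finite_set)
  have "(adjacency_mat vs G *\<^sub>v z) $ i =
      (\<Sum>j<length vs. if (vs ! i, vs ! j) \<in> parcs G then y (vs ! j) else 0)"
    using assms(4-6) by (auto simp: adjacency_mat_def scalar_prod_def lessThan_atLeast0 intro!: sum.cong)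
  also have "\<dots> = (\<Sum>u\<in>pverts G. if (vs ! i, u) \<in> parcs G then y u else 0)"
    using assms(2,3) by (intro sum.reindex_bij_betw bij_betw_nth) auto
  also have "\<dots> = sum y (parcs G `` {vs ! i})"
    by (rule sum.mono_neutral_cong_right) (use Image_parcs_subset[OF assms(1)] fin in auto)
  finally show ?thesis .
qed

text \<open>Take the absolute values of an eigenvector whose eigenvalue has maximum modulus; the
  triangle inequality gives the estimate.\<close>

lemma spectral_radius_subeigenvector:
  assumes G: "pair_graph G" and ne: "pverts G \<noteq> {}"
  obtains w :: "'a \<Rightarrow> real" where "\<And>v. w v \<ge> 0" and "\<exists>v\<in>pverts G. w v > 0"
    and "\<And>v. v \<in> pverts G \<Longrightarrow> graph_spectral_radius G * w v \<le> sum w (parcs G `` {v})"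
proof -
  interpret pair_graph G by fact
  obtain vs where vs: "set vs = pverts G" "distinct vs"
    using finite_distinct_list pair_finite_verts by blast
  let ?n = "length vs" and ?A = "adjacency_mat vs G"
  have A: "?A \<in> carrier_mat ?n ?n" by (simp add: adjacency_mat_def)
  have "?n > 0" using ne vs(1) by auto
  then have "spectral_radius ?A \<in> norm ` spectrum ?A"
    by (rule spectral_radius_mem_max(1)[OF A])
  then obtain \<mu> z where lam: "graph_spectral_radius G = cmod \<mu>" and z: "eigenvector ?A z \<mu>"
    unfolding graph_spectral_radius_eq[OF vs(2,1)] by (auto simp: spectrum_def eigenvalue_def)
  then have z: "dim_vec z = ?n" "z \<noteq> 0\<^sub>v ?n" "?A *\<^sub>v z = \<mu> \<cdot>\<^sub>v z"
    by (auto simp: eigenvector_def adjacency_mat_def)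
  \<comment> \<open>\<open>y\<close> carries the eigenvector from indices to vertices; its values
    off the vertex set are arbitrary.\<close>
  define y where "y v = z $ (inv_into {..<?n} ((!) vs) v)" for v
  have inj: "inj_on ((!) vs) {..<?n}"
    using vs(2) by (auto simp: inj_on_def nth_eq_iff_index_eq)
  have y: "z $ j = y (vs ! j)" if "j < ?n" for j
    using that inv_into_f_f[OF inj] by (simp add: y_def)
  show thesis
  proof (rule that[of "\<lambda>v. cmod (y v)"])
    obtain j where "j < ?n" "z $ j \<noteq> 0"
      using z(1,2) by (metis eq_vecI index_zero_vec)
    then show "\<exists>v\<in>pverts G. cmod (y v) > 0"
      using y vs(1) by (intro bexI[of _ "vs ! j"]) auto
    fix v assume "v \<in> pverts G"
    then obtain i where i: "i < ?n" "v = vs ! i"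
      using vs(1) by (metis in_set_conv_nth)
    have "\<mu> * y v = (?A *\<^sub>v z) $ i"
      using i y z by simp
    also have "\<dots> = sum y (parcs G `` {v})"
      using adjacency_mat_mult_vec[OF G vs(2,1) i(1) z(1), of y] y i(2) by simp
    finally show "graph_spectral_radius G * cmod (y v) \<le> (\<Sum>v\<in>parcs G `` {v}. cmod (y v))"
      unfolding lam by (metis norm_mult norm_sum)
  qed simp
qed

text \<open>The real function \<open>y\<close>, read as a complex vector, puts \<open>\<mu>\<close>
  into the spectrum, and \<open>\<mu>\<close> is at most its modulus.\<close>

lemma spectral_radius_ge_eigenvalue:
  fixes y :: "'a \<Rightarrow> real"
  assumes G: "pair_graph G" and "\<exists>v\<in>pverts G. y v \<noteq> 0"
    and ev: "\<And>v. v \<in> pverts G \<Longrightarrow> sum y (parcs G `` {v}) = \<mu> * y v"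
  shows "\<mu> \<le> graph_spectral_radius G"
proof -
  interpret pair_graph G by fact
  obtain vs where vs: "set vs = pverts G" "distinct vs"
    using finite_distinct_list pair_finite_verts by blast
  let ?n = "length vs" and ?A = "adjacency_mat vs G"
  have A: "?A \<in> carrier_mat ?n ?n" by (simp add: adjacency_mat_def)
  define z where "z = vec ?n (\<lambda>j. complex_of_real (y (vs ! j)))"
  obtain j where j: "j < ?n" "y (vs ! j) \<noteq> 0"
    using assms(2) vs(1) by (metis in_set_conv_nth)
  have "?A *\<^sub>v z = complex_of_real \<mu> \<cdot>\<^sub>v z"
  proof (rule eq_vecI)
    fix i assume "i < dim_vec (complex_of_real \<mu> \<cdot>\<^sub>v z)"
    then have i: "i < ?n" by (simp add: z_def)
    then have "(?A *\<^sub>v z) $ i = (\<Sum>u\<in>parcs G `` {vs ! i}. complex_of_real (y u))"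
      by (intro adjacency_mat_mult_vec[OF G vs(2,1)]) (auto simp: z_def)
    also have "\<dots> = complex_of_real (\<mu> * y (vs ! i))"
      using ev[of "vs ! i"] i vs(1) by (metis nth_mem of_real_sum)
    finally show "(?A *\<^sub>v z) $ i = (complex_of_real \<mu> \<cdot>\<^sub>v z) $ i"
      using i by (simp add: z_def)
  qed (simp add: adjacency_mat_def z_def)
  moreover have "z \<noteq> 0\<^sub>v ?n"
    using j by (metis index_vec index_zero_vec(1) of_real_eq_0_iff z_def)
  ultimately have "complex_of_real \<mu> \<in> spectrum ?A"
    using A by (auto simp: spectrum_def eigenvalue_def eigenvector_def z_def
        intro!: exI[of _ z])
  then have "cmod (complex_of_real \<mu>) \<in> cmod ` spectrum ?A"
    by (rule imageI)
  then have "cmod (complex_of_real \<mu>) \<le> spectral_radius ?A"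
    using j(1) by (intro spectral_radius_mem_max(2)[OF A]) auto
  then show ?thesis
    unfolding graph_spectral_radius_eq[OF vs(2,1)] by simp
qed

text \<open>Pair \<open>y\<close> with a nonnegative subeigenvector \<open>w\<close>. Moving the
  adjacency operator from \<open>w\<close> to \<open>y\<close> bounds the spectral radius times the
  pairing by \<open>\<mu>\<close> times the pairing, which is positive.\<close>

lemma spectral_radius_le_Collatz:
  fixes y :: "'a \<Rightarrow> real"
  assumes G: "pair_graph G" and ne: "pverts G \<noteq> {}"
    and pos: "\<And>v. v \<in> pverts G \<Longrightarrow> y v > 0"
    and le: "\<And>v. v \<in> pverts G \<Longrightarrow> sum y (parcs G `` {v}) \<le> \<mu> * y v"
  shows "graph_spectral_radius G \<le> \<mu>"
proof -
  interpret pair_graph G by fact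
  let ?V = "pverts G" and ?\<rho> = "graph_spectral_radius G"
  obtain w where w: "\<And>v. w v \<ge> 0" "\<exists>v\<in>?V. w v > 0"
      "\<And>v. v \<in> ?V \<Longrightarrow> ?\<rho> * w v \<le> sum w (parcs G `` {v})"
    using spectral_radius_subeigenvector[OF G ne] by blast
  have E: "sym (parcs G)" "parcs G \<subseteq> ?V \<times> ?V"
    using pair_sym_arcs in_arcsD1 in_arcsD2 by (auto simp: symmetric_def)
  have pos_sum: "(\<Sum>v\<in>?V. y v * w v) > 0"
  proof -
    obtain v where "v \<in> ?V" "w v > 0" using w(2) by blast
    then show ?thesis
      using pos w(1) pair_finite_verts
      by (intro sum_pos2[of _ v]) (auto intro: mult_nonneg_nonneg less_imp_le)
  qed
  have "?\<rho> * (\<Sum>v\<in>?V. y v * w v) = (\<Sum>v\<in>?V. y v * (?\<rho> * w v))"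
    by (simp add: sum_distrib_left algebra_simps)
  also have "\<dots> \<le> (\<Sum>v\<in>?V. y v * sum w (parcs G `` {v}))"
    by (intro sum_mono mult_left_mono) (use w pos in \<open>auto intro: less_imp_le\<close>)
  also have "\<dots> = (\<Sum>v\<in>?V. sum y (parcs G `` {v}) * w v)"
    by (rule sum_nbrs_swap[OF pair_finite_verts E])
  also have "\<dots> \<le> (\<Sum>v\<in>?V. \<mu> * y v * w v)"
    by (intro sum_mono mult_right_mono) (use w le in auto)
  also have "\<dots> = \<mu> * (\<Sum>v\<in>?V. y v * w v)"
    by (simp add: sum_distrib_left algebra_simps)
  finally show ?thesis
    using pos_sum by simp
qed

text \<open>
  Equality in the Collatz bound forces a subeigenvector of the subgraph to be an eigenvector of the
  whole graph that vanishes at the ends of a missing arc; a vertex adjacent to all others then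
  spreads the zero everywhere.
\<close>

lemma spectral_radius_less_subgraph:
  fixes y :: "'a \<Rightarrow> real"
  assumes G: "pair_graph G" and H: "pair_graph H"
    and V: "pverts G = pverts H" and sub: "parcs G \<subset> parcs H"
    and pos: "\<And>v. v \<in> pverts H \<Longrightarrow> y v > 0"
    and ev: "\<And>v. v \<in> pverts H \<Longrightarrow> sum y (parcs H `` {v}) = \<mu> * y v"
    and dom: "c \<in> pverts H" "\<And>v. v \<in> pverts H \<Longrightarrow> v \<noteq> c \<Longrightarrow> (c, v) \<in> parcs H"
  shows "graph_spectral_radius G < \<mu>"
proof -
  interpret G: pair_graph G by fact
  interpret H: pair_graph H by fact
  let ?V = "pverts H"
  have fin: "finite (parcs G `` {v})" "finite (parcs H `` {v})" for v
    using Image_parcs_subset[OF G, of v] Image_parcs_subset[OF H, of v] H.pair_finite_verts V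
    by (metis finite_subset)+
  have mono: "sum f (parcs G `` {v}) \<le> sum f (parcs H `` {v})"
    if "\<And>v. v \<in> ?V \<Longrightarrow> f v \<ge> 0" for f :: "'a \<Rightarrow> real" and v
    using that sub fin Image_parcs_subset[OF H, of v] by (intro sum_mono2) auto
  have ne: "pverts G \<noteq> {}" using dom(1) V by auto
  have le: "graph_spectral_radius G \<le> \<mu>"
  proof (rule spectral_radius_le_Collatz[OF G ne])
    fix v assume "v \<in> pverts G"
    then have v: "v \<in> ?V" using V by simp
    show "y v > 0" by (rule pos[OF v])
    show "sum y (parcs G `` {v}) \<le> \<mu> * y v"
      using mono[of y v] pos ev[OF v] by (force intro: less_imp_le)
  qed
  have "graph_spectral_radius G \<noteq> \<mu>"
  proof
    assume eq: "graph_spectral_radius G = \<mu>"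
    obtain w where w: "\<And>v. w v \<ge> 0" "\<exists>v\<in>?V. w v > 0"
        "\<And>v. v \<in> ?V \<Longrightarrow> \<mu> * w v \<le> sum w (parcs G `` {v})"
      using spectral_radius_subeigenvector[OF G ne] eq V by metis
    have E: "sym (parcs H)" "parcs H \<subseteq> ?V \<times> ?V"
      using H.pair_sym_arcs H.in_arcsD1 H.in_arcsD2 by (auto simp: symmetric_def)
    have le_H: "\<mu> * w v \<le> sum w (parcs H `` {v})" if "v \<in> ?V" for v
      using w(3)[OF that] mono[of w v] w(1) by force
    have "(\<Sum>v\<in>?V. y v * (sum w (parcs H `` {v}) - \<mu> * w v)) =
        (\<Sum>v\<in>?V. y v * sum w (parcs H `` {v})) - (\<Sum>v\<in>?V. \<mu> * y v * w v)"
      by (simp add: sum_subtractf[symmetric] algebra_simps)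
    also have "\<dots> = (\<Sum>v\<in>?V. sum y (parcs H `` {v}) * w v) - (\<Sum>v\<in>?V. \<mu> * y v * w v)"
      by (simp only: sum_nbrs_swap[OF H.pair_finite_verts E])
    also have "\<dots> = 0"
      using ev by simp
    \<comment> \<open>The summands are nonnegative by \<open>le_H\<close> and sum to zero, so each
      vanishes and \<open>w\<close> is an eigenvector for \<open>H\<close>.\<close>
    finally have "\<forall>v\<in>?V. y v * (sum w (parcs H `` {v}) - \<mu> * w v) = 0"
      using pos le_H less_imp_le
      by (subst (asm) sum_nonneg_eq_0_iff) (auto intro!: mult_nonneg_nonneg simp: H.pair_finite_verts)
    then have w_ev: "sum w (parcs H `` {v}) = \<mu> * w v" if "v \<in> ?V" for v
      using pos that by fastforce
    have zero_nbr: "w u = 0" if "w v = 0" "(v, u) \<in> parcs H" for u v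
    proof -
      have "sum w (parcs H `` {v}) = 0"
        using w_ev[of v] that H.in_arcsD1 by simp
      then show ?thesis
        using that(2) w(1) fin by (subst (asm) sum_nonneg_eq_0_iff) auto
    qed
    obtain a b where ab: "(a, b) \<in> parcs H" "(a, b) \<notin> parcs G"
      using sub by auto
    have a: "a \<in> ?V" "b \<in> ?V" using ab(1) H.in_arcsD1 H.in_arcsD2 by auto
    have "insert b (parcs G `` {a}) \<subseteq> parcs H `` {a}"
      using sub ab by auto
    then have "sum w (insert b (parcs G `` {a})) \<le> sum w (parcs H `` {a})"
      using fin w(1) by (intro sum_mono2) auto
    \<comment> \<open>The neighbours of \<open>a\<close> in \<open>G\<close> already contribute at
      least \<open>\<mu> * w a\<close>, so the extra neighbour \<open>b\<close> must have weight
      zero.\<close>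
    then have "w b + sum w (parcs G `` {a}) \<le> \<mu> * w a"
      using ab(2) fin w_ev[OF a(1)] by simp
    then have "w b = 0"
      using w(1)[of b] w(3)[OF a(1)] by simp
    then have "w c = 0"
      using zero_nbr[of b c] dom(2)[OF a(2)] E(1) by (cases "b = c") (auto dest: symD)
    then have "w v = 0" if "v \<in> ?V" for v
      using zero_nbr[of c v] dom(2)[OF that] by (cases "v = c") auto
    then show False using w(2) by auto
  qed
  with le show ?thesis by simp
qed

section \<open>Complements without a large star\<close>

text \<open>By irreflexivity an arc leaving \<open>x\<close> differs from every arc entering
  \<open>x\<close>, so the star at \<open>x\<close> takes up two arcs per neighbour.\<close>

lemma two_card_Image_le:
  assumes "finite R" and "sym R" and "irrefl R"
  shows "2 * card (R `` {x}) \<le> card R"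
proof -
  have fin: "finite (R `` {x})"
    using assms(1) by (rule finite_Image)
  have "({x} \<times> R `` {x}) \<inter> (R `` {x} \<times> {x}) = {}"
    using assms(3) by (auto dest: irreflD)
  then have "card ({x} \<times> R `` {x} \<union> R `` {x} \<times> {x}) = 2 * card (R `` {x})"
    using fin by (subst card_Un_disjoint) (auto simp: card_cartesian_product)
  moreover have "{x} \<times> R `` {x} \<union> R `` {x} \<times> {x} \<subseteq> R"
    using assms(2) by (auto dest: symD)
  ultimately show ?thesis
    using card_mono[OF assms(1)] by metis
qed

text \<open>
  Split the degrees by whether an edge meets \<open>v\<close>: the \<open>e\<close> edges avoiding \<open>v\<close> contribute a part of each
  degree that is at most \<open>e\<close> and sums to \<open>2 * e\<close>.
\<close>

lemma sum_degree_squares_le: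
  fixes d :: "'a \<Rightarrow> nat"
  assumes fin: "finite V" and R: "sym R" "irrefl R" "R \<subseteq> V \<times> V"
    and d: "\<And>x. d x = card (R `` {x})" and v: "v \<in> V" and e: "card R = 2 * (d v + e)"
  shows "(\<Sum>x\<in>V. (d x)\<^sup>2) \<le> (d v)\<^sup>2 + d v + 2 * e\<^sup>2 + 4 * e"
proof -
  have finR: "finite R" using R(3) fin finite_subset by blast
  let ?W = "V - {v}"
  define S where "S = R - {(x, y). x = v \<or> y = v}"
  define i where "i x = (if (x, v) \<in> R then 1 else 0::nat)" for x
  have S: "finite S" "sym S" "irrefl S" "S \<subseteq> ?W \<times> ?W"
    using finR R by (auto simp: S_def sym_def irrefl_def)
  have d_split: "d x = card (S `` {x}) + i x" if "x \<in> ?W" for x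
  proof (cases "(x, v) \<in> R")
    case True
    then have "R `` {x} = insert v (S `` {x})" using that by (auto simp: S_def)
    moreover have "v \<notin> S `` {x}" by (auto simp: S_def)
    ultimately show ?thesis
      using True finite_Image[OF S(1)] by (simp add: d i_def)
  next
    case False
    then have "R `` {x} = S `` {x}" using that by (auto simp: S_def)
    then show ?thesis using False by (simp add: d i_def)
  qed
  have "(\<Sum>x\<in>?W. i x) = card {x \<in> ?W. (x, v) \<in> R}"
    unfolding i_def using fin by (simp add: sum.If_cases Int_def)
  also have "{x \<in> ?W. (x, v) \<in> R} = R `` {v}"
    using R by (auto dest: symD irreflD)
  finally have sum_i: "(\<Sum>x\<in>?W. i x) = d v" by (simp add: d)
  have cardS: "card S = (\<Sum>x\<in>?W. card (S `` {x}))"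
    using fin by (intro card_eq_sum_card_Image S(4)) auto
  have "card R = d v + (\<Sum>x\<in>?W. d x)"
    unfolding card_eq_sum_card_Image[OF fin R(3)] d using fin v by (rule sum.remove)
  also have "(\<Sum>x\<in>?W. d x) = card S + d v"
    by (simp add: d_split sum.distrib sum_i cardS)
  finally have cS: "card S = 2 * e" using e by simp
  \<comment> \<open>The degree is \<open>s + i x\<close> with \<open>s \<le> e\<close> and
    \<open>i x \<le> 1\<close>; then \<open>s * s \<le> e * s\<close>, and the mixed term is at most
    \<open>2 * s\<close>.\<close>
  have "(d x)\<^sup>2 \<le> (e + 2) * card (S `` {x}) + i x" if "x \<in> ?W" for x
  proof -
    have "2 * card (S `` {x}) \<le> 2 * e"
      using two_card_Image_le[OF S(1-3), of x] cS by simp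
    then have "card (S `` {x}) * card (S `` {x}) \<le> e * card (S `` {x})"
      by (intro mult_le_mono1) simp
    moreover have "i x * card (S `` {x}) \<le> card (S `` {x})" "i x * i x = i x"
      by (auto simp: i_def)
    moreover have "(d x)\<^sup>2 = card (S `` {x}) * card (S `` {x}) + 2 * (i x * card (S `` {x})) + i x * i x"
      "(e + 2) * card (S `` {x}) = e * card (S `` {x}) + 2 * card (S `` {x})"
      unfolding d_split[OF that] power2_eq_square by (simp_all add: algebra_simps)
    ultimately show ?thesis by linarith
  qed
  then have "(\<Sum>x\<in>?W. (d x)\<^sup>2) \<le> (\<Sum>x\<in>?W. (e + 2) * card (S `` {x}) + i x)"
    by (rule sum_mono)
  also have "\<dots> = (e + 2) * card S + d v"
    by (simp add: sum.distrib sum_i cardS sum_distrib_left)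
  also have "\<dots> = 2 * e\<^sup>2 + 4 * e + d v"
    by (simp add: cS power2_eq_square algebra_simps)
  finally show ?thesis
    using sum.remove[OF fin v, of "\<lambda>x. (d x)\<^sup>2"] by simp
qed

text \<open>In the application \<open>b\<close> counts edges, \<open>D\<close> is the maximum
  degree, \<open>e\<close> counts the edges missing a vertex of that degree, and \<open>S\<close> is
  the sum of squared degrees. If the bound failed, \<open>S1\<close> would force
  \<open>2 * e \<le> b\<close>, and in that range \<open>S2\<close> is contradictory.\<close>

lemma sum_degree_squares_arith:
  fixes b q e D S :: int
  assumes q: "q \<ge> 1" and b: "b \<ge> 2 * q\<^sup>2 + 6 * q + 5" and e: "e \<ge> 1" "D + e = b"
    and S1: "S \<le> 2 * D * b" and S2: "S \<le> D\<^sup>2 + D + 2 * e\<^sup>2 + 4 * e"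
  shows "S \<le> b\<^sup>2 - q\<^sup>2"
proof (rule ccontr)
  assume "\<not> S \<le> b\<^sup>2 - q\<^sup>2"
  then have S: "S > b\<^sup>2 - q\<^sup>2" by simp
  have D: "D = b - e" using e by simp
  have q2: "q \<le> q\<^sup>2" using q by (simp add: power2_eq_square)
  have b_gt: "q\<^sup>2 < b" using b q q2 by linarith
  have "2 * e * b < b\<^sup>2 + q\<^sup>2"
    using S S1 unfolding D by (simp add: power2_eq_square algebra_simps)
  also have "\<dots> < (b + 1) * b"
    using b_gt by (simp add: power2_eq_square algebra_simps)
  finally have eb: "2 * e \<le> b"
    using b q q2 by (simp add: mult_less_cancel_right)
  have "2 * e * b < q\<^sup>2 + b + 3 * e\<^sup>2 + 3 * e"
    using S S2 unfolding D by (simp add: power2_eq_square algebra_simps)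
  \<comment> \<open>This product replaces the convex term \<open>2 * e\<^sup>2\<close> by its chord
    between \<open>e = 1\<close> and \<open>e = b / 2\<close>.\<close>
  moreover have "0 \<le> (e - 1) * (b - 2 * e)"
    using e eb by simp
  then have "2 * e\<^sup>2 \<le> e * (b + 2) - b"
    by (simp add: power2_eq_square algebra_simps)
  ultimately have "e * (b - 12) + 3 * b < 2 * (q\<^sup>2 + b)"
    by (simp add: power2_eq_square algebra_simps)
  moreover have "1 * (b - 12) \<le> e * (b - 12)"
    using e(1) b q q2 by (intro mult_right_mono) auto
  ultimately have "2 * b < 2 * q\<^sup>2 + 12" by simp
  then show False using b q q2 by simp
qed

text \<open>
  The test vector \<open>y\<close> consists of the first three terms of the Neumann series of \<open>(1 + R / a)\<^sup>-\<^sup>1 1\<close>, the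
  Perron vector that the complement of \<open>R\<close> would have if its eigenvalue were exactly \<open>a - 1\<close>.
\<close>

lemma spectral_radius_le_of_complement:
  fixes d :: "'a \<Rightarrow> nat" and a :: real
  assumes G: "pair_graph G" and ne: "pverts G \<noteq> {}"
    and R: "sym R" "irrefl R" "R \<subseteq> pverts G \<times> pverts G" "R \<inter> parcs G = {}"
    and a: "real (card (pverts G)) = a + 1"
    and d: "\<And>x. d x = card (R `` {x})" and d_less: "\<And>x. x \<in> pverts G \<Longrightarrow> d x < a"
    and squares: "a\<^sup>2 + (\<Sum>x\<in>pverts G. (real (d x))\<^sup>2) \<le> a * card R"
  shows "graph_spectral_radius G \<le> a - 1"
proof -
  interpret pair_graph G by fact
  let ?V = "pverts G"
  have fin: "finite ?V" by (rule pair_finite_verts)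
  define F :: "('a \<Rightarrow> real) \<Rightarrow> 'a \<Rightarrow> real" where "F f x = sum f (R `` {x})" for f x
  define D where "D x = real (d x)" for x
  define y where "y x = 1 - D x / a + F D x / a\<^sup>2" for x
  have a0: "a > 0"
    using ne d_less of_nat_0_le_iff by (meson all_not_in_conv le_less_trans)
  have FD: "F D x \<ge> 0" "F (F D) x \<ge> 0" for x
    by (auto simp: F_def D_def intro!: sum_nonneg)
  have F1: "F (\<lambda>_. 1) x = D x" for x
    by (simp add: F_def D_def d)
  have pos: "y x > 0" if "x \<in> ?V" for x
  proof -
    have "D x / a < 1" using d_less[OF that] a0 by (simp add: D_def)
    moreover have "F D x / a\<^sup>2 \<ge> 0" using FD by simp
    ultimately show ?thesis by (simp add: y_def)
  qed
  have "(\<Sum>x\<in>?V. F D x) = (\<Sum>x\<in>?V. (D x)\<^sup>2)"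
    using sum_nbrs_swap[OF fin R(1,3), of "\<lambda>_. 1" D] F1
    by (simp add: F_def D_def power2_eq_square d)
  moreover have "(\<Sum>x\<in>?V. D x) = card R"
    using card_eq_sum_card_Image[OF fin R(3)] by (simp add: D_def d)
  ultimately have "sum y ?V = a + 1 - card R / a + (\<Sum>x\<in>?V. (D x)\<^sup>2) / a\<^sup>2"
    by (simp add: y_def sum.distrib sum_subtractf sum_divide_distrib[symmetric] a)
  \<comment> \<open>The hypothesis \<open>squares\<close> is exactly what makes the total of
    \<open>y\<close> at most \<open>a\<close>.\<close>
  also have "(\<Sum>x\<in>?V. (D x)\<^sup>2) / a\<^sup>2 \<le> (a * card R - a\<^sup>2) / a\<^sup>2"
    using squares by (intro divide_right_mono) (auto simp: D_def)
  also have "(a * card R - a\<^sup>2) / a\<^sup>2 = card R / a - 1"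
    using a0 by (simp add: field_simps power2_eq_square)
  finally have sum_y: "sum y ?V \<le> a" by simp
  show ?thesis
  proof (rule spectral_radius_le_Collatz[OF G ne pos])
    fix x assume x: "x \<in> ?V"
    have RV: "R `` {x} \<subseteq> ?V - {x}"
      using R by (auto dest: irreflD)
    have finRx: "finite (R `` {x})"
      using RV fin finite_subset by blast
    have "parcs G `` {x} \<subseteq> ?V - {x} - R `` {x}"
      using R(4) in_arcsD2 pair_no_loops by fastforce
    then have "sum y (parcs G `` {x}) \<le> sum y (?V - {x} - R `` {x})"
      using fin pos by (intro sum_mono2) (auto intro: less_imp_le)
    also have "\<dots> = sum y ?V - y x - F y x"
      using fin x RV by (simp add: sum_diff F_def sum_diff1)
    also have "F y x = D x - F D x / a + F (F D) x / a\<^sup>2"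
      using F1[of x]
      by (simp add: F_def y_def sum.distrib sum_subtractf sum_divide_distrib[symmetric])
    \<comment> \<open>The term \<open>F (F D) x / a\<^sup>2\<close> enters with a minus sign and is
      dropped; the remaining terms recombine to a multiple of \<open>y x\<close>.\<close>
    finally have "sum y (parcs G `` {x}) \<le> a - y x - D x + F D x / a"
      using sum_y FD(2)[of x] by (smt (verit) divide_nonneg_nonneg zero_le_power2)
    also have "\<dots> = (a - 1) * y x"
      using a0 by (simp add: y_def field_simps power2_eq_square)
    finally show "sum y (parcs G `` {x}) \<le> (a - 1) * y x" .
  qed
qed

text \<open>With \<open>b = n - 1 - q\<close> edges and \<open>a = n - 1 = b + q\<close>, the test
  vector needs the sum of squared degrees to be at most \<open>2 * a * b - a\<^sup>2\<close>, which
  is \<open>b\<^sup>2 - q\<^sup>2\<close>.\<close>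

lemma spectral_radius_le_of_max_degree:
  fixes d :: "'a \<Rightarrow> nat" and n q :: nat
  assumes G: "pair_graph G" and card: "card (pverts G) = n"
    and q: "q \<ge> 1" and n: "n \<ge> 2 * q\<^sup>2 + 7 * q + 6"
    and R: "sym R" "irrefl R" "R \<subseteq> pverts G \<times> pverts G" "R \<inter> parcs G = {}"
    and cardR: "card R = 2 * (n - 1 - q)"
    and deg: "\<And>x. x \<in> pverts G \<Longrightarrow> card (R `` {x}) < n - 1 - q"
  shows "graph_spectral_radius G \<le> real n - 2"
proof -
  interpret pair_graph G by fact
  let ?V = "pverts G"
  define d where "d x = card (R `` {x})" for x
  define b where "b = n - 1 - q"
  have b: "b \<ge> 2 * q\<^sup>2 + 6 * q + 5" "n = b + q + 1" using n by (auto simp: b_def)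
  have fin: "finite ?V" by (rule pair_finite_verts)
  have ne: "?V \<noteq> {}" using card n by auto
  then have "Max (d ` ?V) \<in> d ` ?V"
    using fin by (intro Max_in) auto
  then obtain v where v: "v \<in> ?V" and v_Max: "d v = Max (d ` ?V)"
    by (metis imageE)
  have vmax: "d x \<le> d v" if "x \<in> ?V" for x
    unfolding v_Max using that fin by (intro Max_ge) auto
  define e where "e = b - d v"
  have e: "e \<ge> 1" "d v + e = b" using deg[OF v] by (auto simp: e_def d_def b_def)
  have cR: "card R = 2 * (d v + e)" using cardR e b_def by simp
  define S where "S = (\<Sum>x\<in>?V. (d x)\<^sup>2)"
  \<comment> \<open>Bounding one factor of each square by the maximum degree leaves the degree sum
    \<open>2 * b\<close>.\<close>
  have "S \<le> (\<Sum>x\<in>?V. d v * d x)"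
    unfolding S_def power2_eq_square by (intro sum_mono mult_le_mono1 vmax)
  also have "\<dots> = 2 * d v * b"
    using card_eq_sum_card_Image[OF fin R(3)] cR e
    by (simp add: sum_distrib_left[symmetric] d_def[symmetric])
  finally have S1: "S \<le> 2 * d v * b" .
  have S2: "S \<le> (d v)\<^sup>2 + d v + 2 * e\<^sup>2 + 4 * e"
    unfolding S_def by (rule sum_degree_squares_le[OF fin R(1-3) d_def v cR])
  have "int S \<le> (int b)\<^sup>2 - (int q)\<^sup>2"
  proof (rule sum_degree_squares_arith)
    show "int q \<ge> 1" "int e \<ge> 1" "int (d v) + int e = int b" using q e by auto
    have "int (2 * q\<^sup>2 + 6 * q + 5) \<le> int b" "int S \<le> int (2 * d v * b)"
      "int S \<le> int ((d v)\<^sup>2 + d v + 2 * e\<^sup>2 + 4 * e)"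
      using b(1) S1 S2 by (simp_all only: of_nat_le_iff)
    then show "int b \<ge> 2 * (int q)\<^sup>2 + 6 * int q + 5" "int S \<le> 2 * int (d v) * int b"
      "int S \<le> (int (d v))\<^sup>2 + int (d v) + 2 * (int e)\<^sup>2 + 4 * int e"
      by simp_all
  qed
  then have "real_of_int (int S) \<le> real_of_int ((int b)\<^sup>2 - (int q)\<^sup>2)"
    by (simp only: of_int_le_iff)
  then have S: "real S \<le> (real b)\<^sup>2 - (real q)\<^sup>2" by simp
  let ?a = "real b + real q"
  have "graph_spectral_radius G \<le> ?a - 1"
  proof (rule spectral_radius_le_of_complement[OF G ne R _ d_def])
    show "real (card ?V) = ?a + 1" using card b by simp
    show "real (d x) < ?a" if "x \<in> ?V" for x
      using deg[OF that] by (simp add: d_def b_def)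
    have "(\<Sum>x\<in>?V. (real (d x))\<^sup>2) = real S" by (simp add: S_def)
    then show "?a\<^sup>2 + (\<Sum>x\<in>?V. (real (d x))\<^sup>2) \<le> ?a * real (card R)"
      using S cR unfolding e(2) by (simp add: power2_eq_square algebra_simps)
  qed
  then show ?thesis using b by simp
qed

section \<open>Complements of stars and the extremal graph\<close>

lemma digraph_iso_bijI:
  assumes G: "pair_graph G" and bij: "bij_betw \<phi> (pverts G) (pverts H)"
    and sub: "parcs H \<subseteq> pverts H \<times> pverts H"
    and iff: "\<And>x y. x \<in> pverts G \<Longrightarrow> y \<in> pverts G \<Longrightarrow> (\<phi> x, \<phi> y) \<in> parcs H \<longleftrightarrow> (x, y) \<in> parcs G"
  shows "digraph_iso (with_proj G) (with_proj H)"
proof -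
  interpret pair_graph G by fact
  have inj: "inj_on \<phi> (pverts G)" and surj: "\<phi> ` pverts G = pverts H"
    using bij by (auto simp: bij_betw_def)
  have E: "parcs G \<subseteq> pverts G \<times> pverts G"
    using in_arcsD1 in_arcsD2 by auto
  have arcs: "parcs H = map_prod \<phi> \<phi> ` parcs G"
  proof (intro equalityI subsetI)
    fix e assume e: "e \<in> parcs H"
    then have "e \<in> \<phi> ` pverts G \<times> \<phi> ` pverts G"
      using sub surj by auto
    then obtain x y where "x \<in> pverts G" "y \<in> pverts G" "e = (\<phi> x, \<phi> y)"
      by blast
    then show "e \<in> map_prod \<phi> \<phi> ` parcs G"
      using e iff by (intro image_eqI[of _ _ "(x, y)"]) auto
  next
    fix e assume "e \<in> map_prod \<phi> \<phi> ` parcs G"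
    then show "e \<in> parcs H"
      using E iff by auto
  qed
  define h where "h = \<lparr>iso_verts = \<phi>, iso_arcs = map_prod \<phi> \<phi>,
    iso_head = snd :: 'b \<times> 'b \<Rightarrow> 'b, iso_tail = fst\<rparr>"
  have "inj_on (map_prod \<phi> \<phi>) (parcs G)"
    using map_prod_inj_on[OF inj inj] E by (rule inj_on_subset)
  then have "digraph_isomorphism h"
    using inj wf_digraph by (auto simp: digraph_isomorphism_def h_def)
  moreover have "with_proj H = app_iso h (with_proj G)"
    by (simp add: app_iso_def h_def surj arcs with_proj_def)
  ultimately show ?thesis
    unfolding digraph_iso_def by blast
qed

text \<open>Enumerating \<open>H\<close> by the images of an enumeration of \<open>G\<close> gives
  literally the same adjacency matrix.\<close>

lemma digraph_iso_spectral_radius_eq: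
  assumes G: "pair_graph G" and iso: "digraph_iso (with_proj G) (with_proj H)"
  shows "graph_spectral_radius G = graph_spectral_radius H"
proof -
  interpret pair_graph G by fact
  obtain h where h: "digraph_isomorphism h" and H: "with_proj H = app_iso h (with_proj G)"
    using iso unfolding digraph_iso_def by blast
  define \<phi> where "\<phi> = iso_verts h"
  have inj: "inj_on \<phi> (pverts G)"
    using digraph_isomorphism_inj_on_verts[OF h] by (simp add: \<phi>_def)
  have V: "pverts H = \<phi> ` pverts G"
    using arg_cong[OF H, of verts] by (simp add: \<phi>_def)
  have E: "parcs H = (\<lambda>(u, v). (\<phi> u, \<phi> v)) ` parcs G"
    using arcs_ends_app_iso_eq[OF h] unfolding H[symmetric] by (simp add: \<phi>_def)
  obtain vs where vs: "set vs = pverts G" "distinct vs"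
    using finite_distinct_list pair_finite_verts by blast
  have ws: "distinct (map \<phi> vs)" "set (map \<phi> vs) = pverts H"
    using vs V inj by (simp_all add: distinct_map)
  have "(\<phi> u, \<phi> v) \<in> parcs H \<longleftrightarrow> (u, v) \<in> parcs G" if "u \<in> pverts G" "v \<in> pverts G" for u v
  proof
    assume "(\<phi> u, \<phi> v) \<in> parcs H"
    then obtain a b where ab: "(a, b) \<in> parcs G" "\<phi> u = \<phi> a" "\<phi> v = \<phi> b"
      unfolding E by auto
    then have "u = a" "v = b"
      using inj_onD[OF inj] that in_arcsD1 in_arcsD2 by blast+
    then show "(u, v) \<in> parcs G" using ab(1) by simp
  qed (auto simp: E)
  moreover have "vs ! i \<in> pverts G" if "i < length vs" for i
    unfolding vs(1)[symmetric] using that by (rule nth_mem)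
  ultimately have "adjacency_mat (map \<phi> vs) H = adjacency_mat vs G"
    by (auto simp: adjacency_mat_def intro!: cong_mat)
  then show ?thesis
    using graph_spectral_radius_eq[OF vs(2,1)] graph_spectral_radius_eq[OF ws] by simp
qed

section \<open>Complete graphs from which a star has been removed\<close>

text \<open>Both the extremal graph and the graph containing \<open>G\<close> in the star case have
  this form, on different vertex types.\<close>

definition missing_star :: "'a set \<Rightarrow> 'a \<Rightarrow> 'a set \<Rightarrow> 'a pair_pre_digraph" where
  "missing_star V v L = \<lparr>pverts = V, parcs = V \<times> V - Id - {v} \<times> L - L \<times> {v}\<rparr>"

lemma pair_graph_missing_star:
  assumes "finite V"
  shows "pair_graph (missing_star V v L)"
proof -
  have "finite (V \<times> V - Id - {v} \<times> L - L \<times> {v})" using assms by simp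
  then show ?thesis
    using assms by unfold_locales (auto simp: missing_star_def symmetric_def sym_def)
qed

text \<open>Centre, leaves and remaining vertices have matching sizes, so bijections of the three
  parts can be glued; adjacency of distinct vertices depends only on their parts.\<close>

lemma digraph_iso_missing_star:
  assumes V: "finite V" "v \<in> V" "L \<subseteq> V - {v}" and V': "finite V'" "v' \<in> V'" "L' \<subseteq> V' - {v'}"
    and card: "card V = card V'" "card L = card L'"
  shows "digraph_iso (with_proj (missing_star V v L)) (with_proj (missing_star V' v' L'))"
proof -
  let ?K = "V - {v} - L" and ?K' = "V' - {v'} - L'"
  have fin: "finite L" "finite L'"
    using V(1,3) V'(1,3) by (meson finite_Diff finite_subset)+
  have "card ?K = card ?K'"
    using V V' card fin by (simp add: card_Diff_subset)
  then obtain f where f: "bij_betw f ?K ?K'"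
    using finite_same_card_bij[of ?K ?K'] V(1) V'(1) by auto
  obtain g where g: "bij_betw g L L'"
    using finite_same_card_bij[OF fin card(2)] by auto
  define \<phi> where "\<phi> x = (if x = v then v' else if x \<in> L then g x else f x)" for x
  have \<phi>K: "bij_betw \<phi> ?K ?K'"
    using f by (subst bij_betw_cong[where g = f]) (auto simp: \<phi>_def)
  have \<phi>L: "bij_betw \<phi> L L'"
    using g V(3) by (subst bij_betw_cong[where g = g]) (auto simp: \<phi>_def)
  have \<phi>v: "bij_betw \<phi> {v} {v'}"
    by (auto simp: \<phi>_def bij_betw_def)
  have "bij_betw \<phi> (?K \<union> L \<union> {v}) (?K' \<union> L' \<union> {v'})"
    using V(3) V'(3) by (intro bij_betw_combine \<phi>K \<phi>L \<phi>v) auto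
  moreover have "?K \<union> L \<union> {v} = V" "?K' \<union> L' \<union> {v'} = V'"
    using V V' by auto
  ultimately have bij: "bij_betw \<phi> V V'" by simp
  have mem: "\<phi> x \<in> V'" "\<phi> x = v' \<longleftrightarrow> x = v" "\<phi> x \<in> L' \<longleftrightarrow> x \<in> L" if "x \<in> V" for x
  proof -
    show "\<phi> x \<in> V'" using bij_betwE[OF bij] that by simp
    show "\<phi> x = v' \<longleftrightarrow> x = v"
      using inj_on_eq_iff[OF bij_betw_imp_inj_on[OF bij] that V(2)] by (simp add: \<phi>_def[of v])
    show "\<phi> x \<in> L' \<longleftrightarrow> x \<in> L"
      using bij_betwE[OF \<phi>K] bij_betwE[OF \<phi>L] V'(3) that by (cases "x \<in> ?K") (auto simp: \<phi>_def)
  qed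
  have inj: "\<phi> x = \<phi> y \<longleftrightarrow> x = y" if "x \<in> V" "y \<in> V" for x y
    using bij_betw_imp_inj_on[OF bij] that by (auto dest: inj_onD)
  show ?thesis
  proof (rule digraph_iso_bijI[OF pair_graph_missing_star[OF V(1)]])
    show "bij_betw \<phi> (pverts (missing_star V v L)) (pverts (missing_star V' v' L'))"
      using bij by (simp add: missing_star_def)
    show "parcs (missing_star V' v' L') \<subseteq> pverts (missing_star V' v' L') \<times> pverts (missing_star V' v' L')"
      by (auto simp: missing_star_def)
    show "(\<phi> x, \<phi> y) \<in> parcs (missing_star V' v' L') \<longleftrightarrow> (x, y) \<in> parcs (missing_star V v L)"
      if "x \<in> pverts (missing_star V v L)" "y \<in> pverts (missing_star V v L)" for x y
      using that mem inj by (simp add: missing_star_def)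
  qed
qed

text \<open>
  The quotient of \<open>missing_star\<close> by the partition into \<open>v\<close>, its \<open>p\<close> non-neighbours and its \<open>q\<close> neighbours
  has this cubic as characteristic equation.
\<close>

definition star_cubic :: "nat \<Rightarrow> nat \<Rightarrow> real \<Rightarrow> real" where
  "star_cubic p q t = (t - q + 1) * t * (t - p + 1) - p * q * t - q * (t - p + 1)"

text \<open>The cubic is negative at \<open>p + q - 1\<close> and nonnegative at
  \<open>p + q\<close>. For \<open>n = p + q + 1\<close> the lower end is \<open>n - 2\<close>, the
  value not exceeded when there is no star.\<close>

lemma star_cubic_root:
  assumes "q \<ge> 1"
  obtains \<mu> where "\<mu> > real p + real q - 1" and "star_cubic p q \<mu> = 0"
proof -
  let ?s = "real p + real q"
  have at_s: "star_cubic p q (?s - 1) = - (real q)\<^sup>2"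
    by (simp add: star_cubic_def power2_eq_square algebra_simps)
  have "star_cubic p q ?s = ?s * (?s + 1) - real q * (real q + 1)"
    by (simp add: star_cubic_def algebra_simps)
  moreover have "real q * (real q + 1) \<le> ?s * (?s + 1)"
    by (intro mult_mono) auto
  ultimately have "star_cubic p q ?s \<ge> 0" by linarith
  moreover have "continuous_on {?s - 1..?s} (star_cubic p q)"
    unfolding star_cubic_def by (intro continuous_intros)
  ultimately obtain \<mu> where "\<mu> \<ge> ?s - 1" "star_cubic p q \<mu> = 0"
    using IVT'[of "star_cubic p q" "?s - 1" 0 ?s] at_s by auto
  moreover from this have "\<mu> \<noteq> ?s - 1"
    using at_s assms by auto
  ultimately show thesis using that[of \<mu>] by simp
qed

text \<open>The eigenvector is \<open>\<gamma>\<close> at \<open>v\<close>, \<open>\<beta>\<close>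
  on \<open>L\<close> and \<open>\<alpha>\<close> on the neighbours of \<open>v\<close>. The
  equations at \<open>v\<close> and on \<open>L\<close> fix the ratios, cleared of denominators; the
  remaining equation is the cubic. The lower bound on \<open>\<mu>\<close> makes all values
  positive.\<close>

lemma missing_star_eigenvector:
  fixes V :: "'a set"
  assumes V: "finite V" "v \<in> V" "L \<subseteq> V - {v}" and card: "card L = p" "card V = p + q + 1"
    and q: "q \<ge> 1" and \<mu>: "\<mu> > real p + real q - 1" "star_cubic p q \<mu> = 0"
  obtains y where "\<And>x. y x > 0"
    and "\<And>x. x \<in> V \<Longrightarrow> sum y (parcs (missing_star V v L) `` {x}) = \<mu> * y x"
proof -
  let ?N = "\<lambda>x. parcs (missing_star V v L) `` {x}"
  let ?K = "V - {v} - L"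
  define \<alpha> where "\<alpha> = \<mu> * (\<mu> - p + 1)"
  define \<beta> where "\<beta> = q * \<mu>"
  define \<gamma> where "\<gamma> = q * (\<mu> - p + 1)"
  define y where "y x = (if x = v then \<gamma> else if x \<in> L then \<beta> else \<alpha>)" for x
  have finL: "finite L" using V(1,3) finite_subset by blast
  have cardK: "card ?K = q"
    using V card finL by (simp add: card_Diff_subset)
  have yL: "sum y (L - X) = \<beta> * card (L - X)" for X
    using V(3) by (subst sum.cong[where h = "\<lambda>_. \<beta>"]) (auto simp: y_def)
  have yK: "sum y (?K - X) = \<alpha> * card (?K - X)" for X
    by (subst sum.cong[where h = "\<lambda>_. \<alpha>"]) (auto simp: y_def)
  have "\<mu> > 0" "\<mu> - p + 1 > 0" using \<mu>(1) q by auto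
  then have pos: "\<alpha> > 0" "\<beta> > 0" "\<gamma> > 0"
    using q by (simp_all add: \<alpha>_def \<beta>_def \<gamma>_def)
  have "sum y (?N x) = \<mu> * y x" if x: "x \<in> V" for x
  proof -
    consider "x = v" | "x \<in> L" | "x \<in> ?K" using x by blast
    then show ?thesis
    proof cases
      case 1
      then have "?N x = ?K" using V by (auto simp: missing_star_def)
      then show ?thesis
        using yK[of "{}"] cardK 1 by (simp add: y_def \<alpha>_def \<gamma>_def)
    next
      case 2
      then have xv: "x \<noteq> v" using V(3) by auto
      have "?N x = ?K \<union> (L - {x})" using 2 xv V by (auto simp: missing_star_def)
      moreover have "sum y (?K \<union> (L - {x})) = sum y ?K + sum y (L - {x})"
        using V(1) finL by (intro sum.union_disjoint) auto
      ultimately have "sum y (?N x) = sum y ?K + sum y (L - {x})" by simp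
      also have "\<dots> = \<alpha> * q + \<beta> * (real p - 1)"
      proof -
        have "real (card (L - {x})) = real p - 1"
          using card_Suc_Diff1[OF finL 2] card(1) by linarith
        then show ?thesis using yK[of "{}"] yL[of "{x}"] cardK by simp
      qed
      finally show ?thesis
        using 2 xv by (simp add: y_def \<alpha>_def \<beta>_def algebra_simps)
    next
      case 3
      have "?N x = insert v ((?K - {x}) \<union> L)" using 3 V by (auto simp: missing_star_def)
      moreover have "sum y (insert v ((?K - {x}) \<union> L)) = y v + sum y ((?K - {x}) \<union> L)"
        using V(1,3) finL by (intro sum.insert) auto
      moreover have "sum y ((?K - {x}) \<union> L) = sum y (?K - {x}) + sum y L"
        using V(1) finL by (intro sum.union_disjoint) auto
      ultimately have "sum y (?N x) = y v + (sum y (?K - {x}) + sum y L)" by simp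
      also have "\<dots> = \<gamma> + \<alpha> * (real q - 1) + \<beta> * p"
      proof -
        have "real (card (?K - {x})) = real q - 1"
          using card_Suc_Diff1[of ?K x] V(1) 3 cardK by simp
        then show ?thesis using yK[of "{x}"] yL[of "{}"] card(1) by (simp add: y_def)
      qed
      also have "\<dots> = \<mu> * \<alpha> - star_cubic p q \<mu>"
        by (simp add: star_cubic_def \<alpha>_def \<beta>_def \<gamma>_def algebra_simps)
      finally show ?thesis
        using 3 \<mu>(2) by (simp add: y_def)
    qed
  qed
  moreover have "y x > 0" for x
    using pos by (simp add: y_def)
  ultimately show thesis using that by blast
qed

text \<open>The positive eigenvector serves twice: as a test vector from above and as a witness of
  an eigenvalue from below.\<close>

lemma spectral_radius_missing_star:
  assumes V: "finite V" "v \<in> V" "L \<subseteq> V - {v}" and card: "card L = p" "card V = p + q + 1"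
    and q: "q \<ge> 1" and \<mu>: "\<mu> > real p + real q - 1" "star_cubic p q \<mu> = 0"
  shows "graph_spectral_radius (missing_star V v L) = \<mu>"
proof -
  obtain y where y: "\<And>x. y x > 0"
      "\<And>x. x \<in> V \<Longrightarrow> sum y (parcs (missing_star V v L) `` {x}) = \<mu> * y x"
    by (rule missing_star_eigenvector[OF assms]) blast
  let ?G = "missing_star V v L"
  have G: "pair_graph ?G" "pverts ?G = V"
    using pair_graph_missing_star V(1) by (auto simp: missing_star_def)
  show ?thesis
  proof (rule antisym)
    show "graph_spectral_radius ?G \<le> \<mu>"
      using y G(2) V(2) by (intro spectral_radius_le_Collatz[OF G(1), of y]) auto
    show "\<mu> \<le> graph_spectral_radius ?G"
      using y G(2) V(2) less_imp_neq[OF y(1)]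
      by (intro spectral_radius_ge_eigenvalue[OF G(1), of y]) (auto intro!: bexI[of _ v])
  qed
qed

text \<open>Since \<open>q \<ge> 1\<close>, there is a vertex \<open>c\<close> other than
  \<open>v\<close> and outside \<open>L\<close>; it is adjacent to all others, as the strict
  comparison requires.\<close>

lemma spectral_radius_less_missing_star:
  assumes V: "finite V" "v \<in> V" "L \<subseteq> V - {v}" and card: "card L = p" "card V = p + q + 1"
    and q: "q \<ge> 1" and \<mu>: "\<mu> > real p + real q - 1" "star_cubic p q \<mu> = 0"
    and G: "pair_graph G" "pverts G = V" "parcs G \<subset> parcs (missing_star V v L)"
  shows "graph_spectral_radius G < \<mu>"
proof -
  let ?H = "missing_star V v L"
  have H: "pair_graph ?H" "pverts ?H = V"
    using pair_graph_missing_star V(1) by (auto simp: missing_star_def)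
  obtain y where y: "\<And>x. y x > 0" "\<And>x. x \<in> V \<Longrightarrow> sum y (parcs ?H `` {x}) = \<mu> * y x"
    by (rule missing_star_eigenvector[OF V card q \<mu>]) blast
  have "finite L" using V(1,3) finite_subset by blast
  then have "card (V - {v} - L) = q"
    using V card by (simp add: card_Diff_subset)
  then obtain c where c: "c \<in> V - {v} - L"
    using q by (metis card.empty ex_in_conv not_one_le_zero)
  show ?thesis
  proof (rule spectral_radius_less_subgraph[OF G(1) H(1) _ G(3)])
    show "pverts G = pverts ?H" using G(2) H(2) by simp
    show "y x > 0" for x by (rule y(1))
    show "sum y (parcs ?H `` {x}) = \<mu> * y x" if "x \<in> pverts ?H" for x
      using y(2) that H(2) by simp
    show "c \<in> pverts ?H" using c H(2) by simp
    show "(c, x) \<in> parcs ?H" if "x \<in> pverts ?H" "x \<noteq> c" for x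
      using c that by (auto simp: missing_star_def)
  qed
qed

section \<open>The extremal graph as a complete graph without a star\<close>

lemma parcs_disjoint_union_iff:
  "(Inl a, Inl b) \<in> parcs (disjoint_union G H) \<longleftrightarrow> (a, b) \<in> parcs G"
  "(Inr c, Inr d) \<in> parcs (disjoint_union G H) \<longleftrightarrow> (c, d) \<in> parcs H"
  "(Inl a, Inr d) \<notin> parcs (disjoint_union G H)"
  "(Inr c, Inl b) \<notin> parcs (disjoint_union G H)"
  unfolding disjoint_union_def by force+

lemma parcs_graph_join_iff:
  "(Inl a, Inl b) \<in> parcs (graph_join G H) \<longleftrightarrow> (a, b) \<in> parcs G"
  "(Inr c, Inr d) \<in> parcs (graph_join G H) \<longleftrightarrow> (c, d) \<in> parcs H"
  "(Inl a, Inr d) \<in> parcs (graph_join G H) \<longleftrightarrow> a \<in> pverts G \<and> d \<in> pverts H"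
  "(Inr c, Inl b) \<in> parcs (graph_join G H) \<longleftrightarrow> c \<in> pverts H \<and> b \<in> pverts G"
  by (auto simp: graph_join_def parcs_disjoint_union_iff)

lemma pverts_extremal_graph_iff:
  "Inl a \<in> pverts (extremal_graph n k) \<longleftrightarrow> a < k - 2"
  "Inr (Inl b) \<in> pverts (extremal_graph n k) \<longleftrightarrow> b < n - k + 1"
  "Inr (Inr c) \<in> pverts (extremal_graph n k) \<longleftrightarrow> c = 0"
  by (auto simp: extremal_graph_def graph_join_def disjoint_union_def complete_graph_def)

text \<open>The join supplies every edge at the clique on \<open>k - 2\<close> vertices, so only the
  pairs between \<open>Inr (Inr 0)\<close> and the clique on \<open>n - k + 1\<close> vertices stay
  nonadjacent.\<close>

lemma extremal_graph_eq_missing_star: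
  "extremal_graph n k = missing_star (pverts (extremal_graph n k)) (Inr (Inr 0))
     (Inr ` Inl ` {..<n - k + 1})" (is "?H = ?M")
proof -
  have M: "(x, y) \<in> parcs ?M \<longleftrightarrow> x \<in> pverts ?H \<and> y \<in> pverts ?H \<and> x \<noteq> y \<and>
      \<not> (x = Inr (Inr 0) \<and> y \<in> Inr ` Inl ` {..<n - k + 1}) \<and>
      \<not> (y = Inr (Inr 0) \<and> x \<in> Inr ` Inl ` {..<n - k + 1})" for x y
    by (auto simp: missing_star_def)
  have "pverts (complete_graph r) = {..<r}"
    "(a, b) \<in> parcs (complete_graph r) \<longleftrightarrow> a < r \<and> b < r \<and> a \<noteq> b" for a b r :: nat
    by (simp_all add: complete_graph_def)
  moreover have "Inl a \<in> pverts (disjoint_union G H) \<longleftrightarrow> a \<in> pverts G"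
    "Inr b \<in> pverts (disjoint_union G H) \<longleftrightarrow> b \<in> pverts H"
    for a b and G H :: "nat pair_pre_digraph"
    by (auto simp: disjoint_union_def)
  \<comment> \<open>The quantified form lets \<open>split_sum_all\<close> put constructors for both
    vertices, one case for each pair of summands.\<close>
  ultimately have "\<forall>x y. (x, y) \<in> parcs ?H \<longleftrightarrow> (x, y) \<in> parcs ?M"
    unfolding split_sum_all M pverts_extremal_graph_iff
    unfolding extremal_graph_def parcs_graph_join_iff parcs_disjoint_union_iff
    by (auto simp: image_iff parcs_disjoint_union_iff)
  then have "parcs ?H = parcs ?M" by auto
  then show ?thesis by (simp add: missing_star_def)
qed

section \<open>Clique factors from colourings of the complement, and the conclusion\<close>

text \<open>A colour class is independent in the complement, hence a clique of \<open>G\<close>. As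
  \<open>k > 0\<close>, classes are nonempty, so distinct colours give distinct cliques and there
  are exactly \<open>m\<close> of them.\<close>

lemma clique_factor_of_equitable_coloring:
  assumes G: "pair_graph G" and k: "k > 0"
    and c: "equitable_coloring (pverts G) (pverts G \<times> pverts G - Id - parcs G) k m c"
  shows "\<exists>F. is_clique_factor k m G F"
proof -
  interpret pair_graph G by fact
  let ?V = "pverts G" and ?C = "color_class (pverts G) c"
  define Q where "Q i = \<lparr>pverts = ?C i, parcs = ?C i \<times> ?C i - Id\<rparr>" for i
  have card: "card (?C i) = k" if "i < m" for i
    using c that by (simp add: equitable_coloring_def)
  have disj: "?C i \<inter> ?C j = {}" if "i \<noteq> j" for i j
    using that by (auto simp: color_class_def)
  have finC: "finite (?C i)" for i
    using pair_finite_verts by (simp add: color_class_def)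
  have "inj_on Q {..<m}"
  proof (rule inj_onI)
    fix i j assume ij: "i \<in> {..<m}" "j \<in> {..<m}" "Q i = Q j"
    then have "?C i = ?C j" by (simp add: Q_def)
    moreover have "?C i \<noteq> {}" using card[of i] ij k by auto
    ultimately show "i = j" using disj by blast
  qed
  then have "card (Q ` {..<m}) = m" by (simp add: card_image)
  moreover have "subgraph (with_proj (Q i)) (with_proj G) \<and> K\<^bsub>k\<^esub> (with_proj (Q i))" if "i < m" for i
  proof
    have "(x, y) \<in> parcs G" if "x \<in> ?C i" "y \<in> ?C i" "x \<noteq> y" for x y
    proof (rule ccontr)
      assume "(x, y) \<notin> parcs G"
      then have "(x, y) \<in> ?V \<times> ?V - Id - parcs G" "c x = c y"
        using that by (auto simp: color_class_def)
      then show False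
        using c by (auto simp: equitable_coloring_def proper_coloring_def)
    qed
    then have sub: "parcs (Q i) \<subseteq> parcs G" by (auto simp: Q_def)
    show "K\<^bsub>k\<^esub> (with_proj (Q i))"
      using finC card[OF that] by (auto simp: complete_digraph_pair_def Q_def)
    have "pair_wf_digraph (Q i)"
      by unfold_locales (auto simp: Q_def)
    then have "wf_digraph (with_proj (Q i))"
      by (rule wf_digraph_wp_iff[THEN iffD2])
    then show "subgraph (with_proj (Q i)) (with_proj G)"
      using sub wf_digraph by (auto simp: subgraph_def compatible_def Q_def color_class_def)
  qed
  moreover have "pairwise (\<lambda>C D. pverts C \<inter> pverts D = {}) (Q ` {..<m})"
  proof (rule pairwiseI)
    fix C D assume "C \<in> Q ` {..<m}" "D \<in> Q ` {..<m}" "C \<noteq> D"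
    then obtain i j where "C = Q i" "D = Q j" "i \<noteq> j" by blast
    then show "pverts C \<inter> pverts D = {}" using disj by (simp add: Q_def)
  qed
  moreover have "(\<Union>C\<in>Q ` {..<m}. pverts C) = ?V"
    using c by (auto simp: Q_def color_class_def equitable_coloring_def)
  ultimately have "is_clique_factor k m G (Q ` {..<m})"
    unfolding is_clique_factor_def by auto
  then show ?thesis by blast
qed

theorem theorem1p1:
  fixes k m n :: nat and G :: "'a pair_pre_digraph"
  assumes "k \<ge> 3" and "m \<ge> 2 * k - 1" and "n = k * m"
    and "pair_graph G" and "card (pverts G) = n"
    and "\<not> (\<exists>F. is_clique_factor k m G F)"
  shows "graph_spectral_radius G \<le> graph_spectral_radius (extremal_graph n k) \<and>
    (graph_spectral_radius G = graph_spectral_radius (extremal_graph n k) \<longleftrightarrow>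
      digraph_iso (with_proj G) (with_proj (extremal_graph n k)))"
proof -
  let ?H = "extremal_graph n k" and ?V = "pverts G"
  interpret pair_graph G by fact
  have fin: "finite ?V" by (rule pair_finite_verts)
  \<comment> \<open>In \<open>?H\<close>, the vertex at which edges are missing has degree
    \<open>q\<close> and lacks \<open>p\<close> edges.\<close>
  define q where "q = k - 2"
  define p where "p = n - k + 1"
  have k: "k = q + 2" and q: "q \<ge> 1" using assms(1) by (auto simp: q_def)
  \<comment> \<open>This is \<open>k * (2 * k - 1) \<le> n\<close> in terms of \<open>q\<close>, the
    size condition for the degree squares.\<close>
  have "(q + 2) * (2 * q + 3) \<le> k * m"
    using assms(2) k by (intro mult_le_mono) auto
  then have n: "n \<ge> 2 * q\<^sup>2 + 7 * q + 6"
    using assms(3) by (simp add: power2_eq_square algebra_simps)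
  then have pq: "n = p + q + 1" "p = n - 1 - q" "k \<le> n"
    using k by (auto simp: p_def)
  obtain \<mu> where \<mu>: "\<mu> > real p + real q - 1" "star_cubic p q \<mu> = 0"
    using star_cubic_root[OF q] by blast
  let ?L = "Inr ` Inl ` {..<n - k + 1} :: (nat + (nat + nat)) set"
  have H: "finite (pverts ?H)" "Inr (Inr 0) \<in> pverts ?H" "?L \<subseteq> pverts ?H - {Inr (Inr 0)}"
    by (auto simp: extremal_graph_def graph_join_def disjoint_union_def complete_graph_def)
  have cardL: "card ?L = p"
    by (simp add: card_image p_def)
  have cardH: "card (pverts ?H) = n"
    using assms(1) pq(3) by (intro card_extremal_graph) auto
  have \<rho>H: "graph_spectral_radius ?H = \<mu>"
    using spectral_radius_missing_star[OF H cardL _ q \<mu>] cardH pq(1)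
      extremal_graph_eq_missing_star[of n k] by simp
  \<comment> \<open>A strict inequality settles both claims, since isomorphic graphs have equal
    spectral radius.\<close>
  have strict: ?thesis if "graph_spectral_radius G < \<mu>"
    using that digraph_iso_spectral_radius_eq[OF assms(4)] \<rho>H by force
  define R where "R = ?V \<times> ?V - Id - parcs G"
  have R: "sym R" "irrefl R" "R \<subseteq> ?V \<times> ?V"
    using pair_sym_arcs by (auto simp: R_def sym_def irrefl_def symmetric_def)
  have finR: "finite R" using R(3) fin finite_subset by blast
  have "\<not> equitable_coloring ?V R k m c" for c
    using clique_factor_of_equitable_coloring[OF assms(4), of k m c] assms(1,6) by (auto simp: R_def)
  then have "\<not> card R \<le> 2 * (k * (m - 1))"
    using equitable_coloring_sparse[OF fin _ _ assms(2) R] assms(1,3,5) by auto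
  moreover have "k * (m - 1) = n - k"
    by (simp add: assms(3) diff_mult_distrib2)
  \<comment> \<open>Only \<open>card R \<ge> 2 * (p - 1) + 1\<close> is known; the slack in
    \<open>sym_subset_of_card\<close> still yields \<open>2 * p\<close> arcs.\<close>
  ultimately have "2 * p \<le> card R + 1"
    by (simp add: p_def)
  then obtain S where S: "S \<subseteq> R" "sym S" "card S = 2 * p"
    using sym_subset_of_card[OF finR R(1,2)] by blast
  have S': "irrefl S" "S \<subseteq> ?V \<times> ?V" "S \<inter> parcs G = {}"
    using S(1) by (auto simp: irrefl_def R_def)
  have finS: "finite S" using S(1) finR by (rule finite_subset)
  show ?thesis
  proof (cases "\<forall>x\<in>?V. card (S `` {x}) < p")
    case True
    have "card S = 2 * (n - 1 - q)" "\<forall>x\<in>?V. card (S `` {x}) < n - 1 - q"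
      using S(3) True unfolding pq(2) by blast+
    then have "graph_spectral_radius G \<le> real n - 2"
      by (intro spectral_radius_le_of_max_degree[OF assms(4,5) q n S(2) S'(1-3)]) blast+
    \<comment> \<open>Here \<open>\<mu>\<close> exceeds \<open>p + q - 1\<close>, which is
      \<open>n - 2\<close>.\<close>
    then show ?thesis
      using \<mu>(1) pq(1) by (intro strict) simp
  next
    case False
    then obtain v where v: "v \<in> ?V" "card (S `` {v}) \<ge> p" by force
    define L where "L = S `` {v}"
    \<comment> \<open>At most half of the \<open>2 * p\<close> arcs leave \<open>v\<close>, so
      \<open>v\<close> meets exactly \<open>p\<close> edges and \<open>S\<close> is a star.\<close>
    have cL: "card L = p"
      using v(2) two_card_Image_le[OF finS S(2) S'(1), of v] S(3) by (simp add: L_def)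
    have L: "L \<subseteq> ?V - {v}"
      using S' by (auto simp: L_def dest: irreflD)
    have cV: "card ?V = p + q + 1" using assms(5) pq(1) by simp
    have "(x, x) \<notin> parcs G" for x
      using pair_no_loops by fastforce
    then have sub: "parcs G \<subseteq> parcs (missing_star ?V v L)"
      using S(2) S'(3) in_arcsD1 in_arcsD2
      by (auto simp: missing_star_def L_def dest: symD)
    show ?thesis
    proof (cases "parcs G = parcs (missing_star ?V v L)")
      case True
      then have G: "G = missing_star ?V v L"
        by (simp add: missing_star_def)
      have "digraph_iso (with_proj G) (with_proj ?H)"
        using digraph_iso_missing_star[OF fin v(1) L H] cardL cL cardH assms(5)
          extremal_graph_eq_missing_star[of n k] G by simp
      then show ?thesis
        using digraph_iso_spectral_radius_eq[OF assms(4), of ?H] by simp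
    next
      case False
      then show ?thesis
        using spectral_radius_less_missing_star[OF fin v(1) L cL cV q \<mu> assms(4)] sub
        by (intro strict) blast
    qed
  qed
qed

end
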